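(* Let $B=(f_1,f_2,f_3)\in\mathrm{Link}(S^1,S^1,S^1;\mathbf{R}^3)$ be the Borromean rings, where $$f_1(x)=(0,2\cos x,\sin x),\quad f_2(y)=(\cos y,0,2\sin y),\quad f_3(z)=(2\cos z,\sin z,0),$$ and let $U=(f_1,e_2,f_3)\in\mathrm{Link}(S^1,S^1,S^1;\mathbf{R}^3)$ be the unlink, where $e_2(y)=(\cos y,4,\sin y)$. Then $B$ is not link homotopic to $U$.
   Context: $\mathrm{Link}(S^1,S^1,S^1;\mathbf{R}^3)$ is the space of triples of smooth maps $S^1\to\mathbf{R}^3$ whose images are pairwise disjoint (each individual map may have self-intersections). Two link maps are link homotopic if they are joined by a path in this space, i.e. by a homotopy through triples of maps whose images remain pairwise disjoint. Points of $S^1$ are written as angles. *)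

theory Defs
  imports "HOL-Analysis.Analysis"
begin

text \<open>
  A map on the circle is represented by a function of the angle with period \<open>2 * pi\<close>;
  smoothness on the circle is smoothness of that function on the real line.
\<close>

definition smooth :: "(real \<Rightarrow> 'a::real_normed_vector) \<Rightarrow> bool" where
  "smooth f \<longleftrightarrow> (\<exists>D :: nat \<Rightarrow> real \<Rightarrow> 'a. D 0 = f \<and>
     (\<forall>n x. (D n has_vector_derivative D (Suc n) x) (at x)))"

definition smooth_circle_map :: "(real \<Rightarrow> 'a::real_normed_vector) \<Rightarrow> bool" where
  "smooth_circle_map f \<longleftrightarrow> smooth f \<and> (\<forall>x. f (x + 2 * pi) = f x)"

type_synonym circle_triple = "(real \<Rightarrow> real^3) \<times> (real \<Rightarrow> real^3) \<times> (real \<Rightarrow> real^3)"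

definition Link :: "circle_triple set" where
  "Link = {(f, g, h). smooth_circle_map f \<and> smooth_circle_map g \<and> smooth_circle_map h \<and>
     range f \<inter> range g = {} \<and> range f \<inter> range h = {} \<and> range g \<inter> range h = {}}"

text \<open>
  A path in \<open>Link\<close> is a triple of homotopies, jointly continuous in time and angle, each
  of whose stages lies in \<open>Link\<close>. Joint continuity amounts to continuity of the path
  for uniform convergence, so paths for finer topologies, such as the smooth one, are included.
  By periodicity, continuity on \<open>{0..1} \<times> UNIV\<close> is continuity on the product of the
  unit interval with the circle.
\<close>

definition link_homotopic :: "circle_triple \<Rightarrow> circle_triple \<Rightarrow> bool" where
  "link_homotopic L M \<longleftrightarrow> (\<exists>F G H :: real \<Rightarrow> real \<Rightarrow> real^3.
     continuous_on ({0..1} \<times> UNIV) (\<lambda>(t, x). F t x) \<and>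
     continuous_on ({0..1} \<times> UNIV) (\<lambda>(t, x). G t x) \<and>
     continuous_on ({0..1} \<times> UNIV) (\<lambda>(t, x). H t x) \<and>
     (\<forall>t\<in>{0..1}. (F t, G t, H t) \<in> Link) \<and>
     (F 0, G 0, H 0) = L \<and> (F 1, G 1, H 1) = M)"

definition f1 :: "real \<Rightarrow> real^3" where
  "f1 x = vector [0, 2 * cos x, sin x]"

definition f2 :: "real \<Rightarrow> real^3" where
  "f2 y = vector [cos y, 0, 2 * sin y]"

definition f3 :: "real \<Rightarrow> real^3" where
  "f3 z = vector [2 * cos z, sin z, 0]"

definition e2 :: "real \<Rightarrow> real^3" where
  "e2 y = vector [cos y, 4, sin y]"

definition borromean_rings :: circle_triple where
  "borromean_rings = (f1, f2, f3)"

definition unlink :: circle_triple where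
  "unlink = (f1, e2, f3)"

lemma smooth_circle_map_ellipse:
  "smooth_circle_map (\<lambda>x. cos x *\<^sub>R u + sin x *\<^sub>R v + w)"
proof -
  define D where "D n x = cos (x + real n * pi / 2) *\<^sub>R u + sin (x + real n * pi / 2) *\<^sub>R v
      + (if n = 0 then w else 0)" for n x
  have shift: "x + real (Suc n) * pi / 2 = x + real n * pi / 2 + pi / 2" for n x
    by (simp add: field_simps)
  have D0: "D 0 = (\<lambda>x. cos x *\<^sub>R u + sin x *\<^sub>R v + w)"
    by (simp add: D_def fun_eq_iff)
  have "(D n has_vector_derivative D (Suc n) x) (at x)" for n x
  proof -
    have "D (Suc n) x = - sin (x + real n * pi / 2) *\<^sub>R u + cos (x + real n * pi / 2) *\<^sub>R v"
      unfolding D_def shift by (simp add: cos_add sin_add)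
    then show ?thesis
      unfolding D_def[abs_def] by (auto intro!: derivative_eq_intros)
  qed
  with D0 have "smooth (\<lambda>x. cos x *\<^sub>R u + sin x *\<^sub>R v + w)"
    unfolding smooth_def by blast
  then show ?thesis
    by (simp add: smooth_circle_map_def)
qed

lemma smooth_circle_map_components:
  "smooth_circle_map f1" "smooth_circle_map f2" "smooth_circle_map f3" "smooth_circle_map e2"
proof -
  have "f1 = (\<lambda>x. cos x *\<^sub>R vector [0, 2, 0] + sin x *\<^sub>R vector [0, 0, 1] + 0)"
    by (simp add: fun_eq_iff f1_def vec_eq_iff forall_3)
  then show "smooth_circle_map f1"
    by (rule ssubst) (rule smooth_circle_map_ellipse)
  have "f2 = (\<lambda>x. cos x *\<^sub>R vector [1, 0, 0] + sin x *\<^sub>R vector [0, 0, 2] + 0)"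
    by (simp add: fun_eq_iff f2_def vec_eq_iff forall_3)
  then show "smooth_circle_map f2"
    by (rule ssubst) (rule smooth_circle_map_ellipse)
  have "f3 = (\<lambda>x. cos x *\<^sub>R vector [2, 0, 0] + sin x *\<^sub>R vector [0, 1, 0] + 0)"
    by (simp add: fun_eq_iff f3_def vec_eq_iff forall_3)
  then show "smooth_circle_map f3"
    by (rule ssubst) (rule smooth_circle_map_ellipse)
  have "e2 = (\<lambda>x. cos x *\<^sub>R vector [1, 0, 0] + sin x *\<^sub>R vector [0, 0, 1] + vector [0, 4, 0])"
    by (simp add: fun_eq_iff e2_def vec_eq_iff forall_3)
  then show "smooth_circle_map e2"
    by (rule ssubst) (rule smooth_circle_map_ellipse)
qed

lemma borromean_rings_in_Link: "borromean_rings \<in> Link"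
proof -
  have double: False if "2 * a = b" "a\<^sup>2 = 1" "b\<^sup>2 = 1" for a b :: real
    using that by (auto simp: power2_eq_square)
  have "f1 x \<noteq> f2 y" for x y
  proof
    assume "f1 x = f2 y"
    then have "cos y = 0" "2 * cos x = 0" "sin x = 2 * sin y"
      by (simp_all add: f1_def f2_def vec_eq_iff forall_3)
    then show False
      using double[of "sin y" "sin x"] sin_cos_squared_add[of x] sin_cos_squared_add[of y] by simp
  qed
  moreover have "f1 x \<noteq> f3 y" for x y
  proof
    assume "f1 x = f3 y"
    then have "cos y = 0" "2 * cos x = sin y" "sin x = 0"
      by (simp_all add: f1_def f3_def vec_eq_iff forall_3)
    then show False
      using double[of "cos x" "sin y"] sin_cos_squared_add[of x] sin_cos_squared_add[of y] by simp
  qed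
  moreover have "f2 x \<noteq> f3 y" for x y
  proof
    assume "f2 x = f3 y"
    then have "cos x = 2 * cos y" "sin y = 0" "sin x = 0"
      by (simp_all add: f2_def f3_def vec_eq_iff forall_3)
    then show False
      using double[of "cos y" "cos x"] sin_cos_squared_add[of x] sin_cos_squared_add[of y] by simp
  qed
  ultimately show ?thesis
    unfolding borromean_rings_def Link_def using smooth_circle_map_components by auto
qed

lemma unlink_in_Link: "unlink \<in> Link"
proof -
  have "f1 x \<noteq> e2 y" for x y
  proof
    assume "f1 x = e2 y"
    then have "2 * cos x = 4"
      by (simp add: f1_def e2_def vec_eq_iff forall_3)
    then show False
      using cos_le_one[of x] by linarith
  qed
  moreover have "f1 x \<noteq> f3 y" for x y
    using borromean_rings_in_Link unfolding borromean_rings_def Link_def by blast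
  moreover have "e2 x \<noteq> f3 y" for x y
  proof
    assume "e2 x = f3 y"
    then have "sin y = 4"
      by (simp add: e2_def f3_def vec_eq_iff forall_3)
    then show False
      using sin_le_one[of y] by linarith
  qed
  ultimately show ?thesis
    unfolding unlink_def Link_def using smooth_circle_map_components by auto
qed

end

theory Submission
  imports Defs
begin

text \<open>
  The Borromean rings and the unlink are separated by Milnor's triple linking number, here in an
  analytic form that is defined for smooth closed curves, is invariant under link homotopy as long
  as the pairwise linking numbers vanish, and can be evaluated on the two given links.

  Project along the third axis. For two curves \<open>c\<close> and \<open>d\<close> write \<open>(X, Y, Z) = d y - c x\<close>, let \<open>a\<close> be an
  even \<open>C\<^sup>1\<close> bump supported in \<open>{-e..e}\<close> and \<open>S\<close> its primitive, a step from 0 to 1. The 2-form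
  \<open>S(Z) a(X) a(Y) dX \<and> dY\<close> on the torus of pairs \<open>(x, y)\<close> is a smeared signed count of the crossings
  of the diagram at which \<open>c\<close> passes below \<open>d\<close>. It stays closed while the two curves move, because
  \<open>a(X) a(Y) a(Z) = 0\<close> when they stay apart; its integral is the linking number. The triple linking
  number follows the Gauss diagram formula: for crossings \<open>AB\<close> and \<open>BC\<close>, or \<open>AB\<close> and \<open>AC\<close>, or \<open>AC\<close>
  and \<open>BC\<close>, one counts the pairs of crossings that occur in the right order on the shared
  component. In smeared form each count is the integral of a primitive of one closed 1-form on a
  circle against another (\<open>cup\<close>).

  When the curves move, the time derivative of such an integral is minus the integral of the wedge
  product of the two closed 2-forms over the torus of triples \<open>(x, y, z)\<close> (\<open>cup_has_derivative\<close>).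
  The three wedge products are concentrated near the triple points of the projection.
  There the step functions of the three height differences are 0 or 1 and satisfy the Arnold relation
  (\<open>arnold_height\<close>), which is also how Gauss diagram formulas survive a third Reidemeister move.
  Their bump factors \<open>a(p) a(q)\<close>, \<open>a(p) a(p + q)\<close> and \<open>a(p + q) a(q)\<close> are different, but cohomologous with
  compact support, because \<open>a(q) - a(p + q)\<close> is the \<open>q\<close>-derivative of \<open>S(q) - S(p + q)\<close>. The resulting
  four correction forms are integrated over the three-torus and added to the three counts, and the
  sum has derivative zero (\<open>triple_linking_constant\<close>). No condition is imposed on two points of
  the same component, so this is invariance under link homotopy and not only under isotopy.

  A homotopy that is merely continuous in time is cut into short steps, on each of which the
  stages are joined by straight lines; these are smooth motions, and they keep the components apart.
  For the unlink every term vanishes. For the Borromean rings a single count is left, and its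
  integrand has a constant sign (\<open>triple_linking_borromean\<close>).
\<close>

section \<open>Integrals over the circle\<close>

definition circle_integral :: "(real \<Rightarrow> real) \<Rightarrow> real" where
  "circle_integral f = integral {0..2 * pi} f"

lemma circ_cong: "(\<And>x. f x = g x) \<Longrightarrow> circle_integral f = circle_integral g"
  by (metis ext)

lemma circ_zero [simp]: "circle_integral (\<lambda>x. 0) = 0"
  by (simp add: circle_integral_def)

lemma circ_cmult: "circle_integral (\<lambda>x. c * f x) = c * circle_integral f"
  by (simp add: circle_integral_def)

lemma circ_multc: "circle_integral (\<lambda>x. f x * c) = circle_integral f * c"
  by (simp add: circle_integral_def)

lemma circ_add:
  assumes "continuous_on UNIV f" "continuous_on UNIV g"
  shows "circle_integral (\<lambda>x. f x + g x) = circle_integral f + circle_integral g"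
  unfolding circle_integral_def
  by (intro integral_add integrable_continuous_real; rule continuous_on_subset[OF assms(1)] continuous_on_subset[OF assms(2)]; simp)

lemma circ_diff:
  assumes "continuous_on UNIV f" "continuous_on UNIV g"
  shows "circle_integral (\<lambda>x. f x - g x) = circle_integral f - circle_integral g"
  unfolding circle_integral_def
  by (intro integral_diff integrable_continuous_real; rule continuous_on_subset[OF assms(1)] continuous_on_subset[OF assms(2)]; simp)

lemma circ_uminus: "circle_integral (\<lambda>x. - f x) = - circle_integral f"
  by (simp add: circle_integral_def)

lemma circ_derivative:
  assumes "\<And>x. (f has_real_derivative f' x) (at x)"
  shows "circle_integral f' = f (2 * pi) - f 0"
proof -
  have "(f' has_integral (f (2 * pi) - f 0)) {0..2 * pi}"
    by (rule fundamental_theorem_of_calculus)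
      (auto intro!: has_field_derivative_at_within assms
        simp: has_real_derivative_iff_has_vector_derivative[symmetric])
  then show ?thesis unfolding circle_integral_def by (rule integral_unique)
qed

lemma continuous_on_circ:
  fixes f :: "'a::topological_space \<Rightarrow> real \<Rightarrow> real"
  assumes "continuous_on UNIV (\<lambda>(p, x). f p x)"
  shows "continuous_on UNIV (\<lambda>p. circle_integral (f p))"
proof -
  have "continuous_on (UNIV \<times> cbox 0 (2 * pi)) (\<lambda>(p, x). f p x)"
    using assms by (rule continuous_on_subset) simp
  from integral_continuous_on_param[OF this] show ?thesis
    by (simp add: circle_integral_def)
qed

lemma circ_has_derivative:
  assumes deriv: "\<And>t x. ((\<lambda>t. f t x) has_real_derivative f' t x) (at t)"
    and f: "continuous_on UNIV (\<lambda>(t, x). f t x)"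
    and f': "continuous_on UNIV (\<lambda>(t, x). f' t x)"
  shows "((\<lambda>t. circle_integral (f t)) has_real_derivative circle_integral (f' t)) (at t)"
proof -
  have "((\<lambda>t. integral (cbox 0 (2 * pi)) (f t)) has_field_derivative
          integral (cbox 0 (2 * pi)) (f' t)) (at t within UNIV)"
  proof (rule leibniz_rule_field_derivative)
    show "f t integrable_on cbox 0 (2 * pi)" for t
    proof (rule integrable_continuous)
      show "continuous_on (cbox 0 (2 * pi)) (f t)"
        using continuous_on_compose2[OF f, of "cbox 0 (2 * pi)" "\<lambda>x. (t, x)"]
        by (simp add: continuous_intros)
    qed
    show "continuous_on (UNIV \<times> cbox 0 (2 * pi)) (\<lambda>(t, x). f' t x)"
      using f' by (rule continuous_on_subset) simp
  qed (auto simp: deriv)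
  then show ?thesis by (simp add: circle_integral_def)
qed

lemma circ_swap:
  assumes "continuous_on UNIV (\<lambda>(x, y). f x y)"
  shows "circle_integral (\<lambda>x. circle_integral (\<lambda>y. f x y)) = circle_integral (\<lambda>y. circle_integral (\<lambda>x. f x y))"
proof -
  have "continuous_on (cbox (0, 0) (2 * pi, 2 * pi)) (\<lambda>(x, y). f x y)"
    using assms by (rule continuous_on_subset) simp
  from integral_swap_continuous[OF this] show ?thesis
    by (simp add: circle_integral_def)
qed

text \<open>
  The primitive of \<open>w\<close> that vanishes at 0. Integrating along the segment from 0 to \<open>y\<close>, parametrised by
  the unit interval, makes it smooth in parameters by differentiation under the integral, and correct
  for either sign of \<open>y\<close>.
\<close>

definition primitive :: "(real \<Rightarrow> real) \<Rightarrow> real \<Rightarrow> real" where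
  "primitive w y = integral {0..1} (\<lambda>s. y * w (y * s))"

lemma primitive_eq_local:
  assumes S: "convex S" "0 \<in> S" "y \<in> S"
    and W: "\<And>x. x \<in> S \<Longrightarrow> (W has_real_derivative w x) (at x within S)"
  shows "primitive w y = W y - W 0"
proof -
  have in_S: "y * s \<in> S" if "s \<in> {0..1}" for s
    using convexD[OF S(1,2,3), of "1 - s" s] that by (simp add: mult.commute)
  have "((\<lambda>s. y * w (y * s)) has_integral (W (y * 1) - W (y * 0))) {0..1}"
  proof (rule fundamental_theorem_of_calculus)
    fix s :: real assume s: "s \<in> {0..1}"
    have "((\<lambda>s. W (y * s)) has_real_derivative w (y * s) * y) (at s within {0..1})"
      using DERIV_image_chain[of W "w (y * s)" "\<lambda>s. y * s" s "{0..1}" y]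
        has_field_derivative_subset[OF W[OF in_S[OF s]], of "(\<lambda>s. y * s) ` {0..1}"] in_S
      by (auto simp: o_def image_subset_iff intro!: derivative_eq_intros)
    then show "((\<lambda>s. W (y * s)) has_vector_derivative y * w (y * s)) (at s within {0..1})"
      by (simp add: has_real_derivative_iff_has_vector_derivative mult.commute)
  qed simp
  then show ?thesis unfolding primitive_def by (subst integral_unique) simp_all
qed

lemma primitive_eq:
  assumes "\<And>x. (W has_real_derivative w x) (at x)"
  shows "primitive w y = W y - W 0"
  using assms by (intro primitive_eq_local[of UNIV]) auto

lemma primitive_has_derivative:
  assumes "continuous_on UNIV w"
  shows "(primitive w has_real_derivative w y) (at y)"
proof -
  define R where "R = \<bar>y\<bar> + 1"
  have "continuous_on {-R..R} w"
    using assms by (rule continuous_on_subset) simp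
  then obtain W where W: "\<And>x. x \<in> {-R..R} \<Longrightarrow> (W has_vector_derivative w x) (at x within {-R..R})"
    using antiderivative_continuous by blast
  have eq: "primitive w z = W z - W 0" if "z \<in> {-R<..<R}" for z
    using W that by (intro primitive_eq_local[of "{-R..R}"])
      (auto simp: has_real_derivative_iff_has_vector_derivative R_def)
  have y: "y \<in> {-R<..<R}" by (auto simp: R_def)
  have "(W has_real_derivative w y) (at y)"
    using W[of y] y at_within_Icc_at[of "-R" y R]
    by (simp add: has_real_derivative_iff_has_vector_derivative)
  then have "((\<lambda>z. W z - W 0) has_real_derivative w y) (at y)"
    by (auto intro!: derivative_eq_intros)
  then show ?thesis
    by (rule has_field_derivative_transform_within_open[OF _ open_greaterThanLessThan y]) (simp add: eq)
qed

lemma primitive_0 [simp]: "primitive w 0 = 0"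
  by (simp add: primitive_def)

lemma primitive_period:
  assumes "continuous_on UNIV w"
  shows "primitive w (2 * pi) = circle_integral w"
  using circ_derivative[OF primitive_has_derivative[OF assms]] by simp

lemma continuous_on_primitive:
  fixes w :: "real \<Rightarrow> real \<Rightarrow> real"
  assumes "continuous_on UNIV (\<lambda>(t, y). w t y)"
  shows "continuous_on UNIV (\<lambda>(t, y). primitive (w t) y)"
proof -
  have w: "continuous_on UNIV (\<lambda>q. w (f q) (g q))"
    if "continuous_on UNIV f" "continuous_on UNIV g" for f g :: "(real \<times> real) \<times> real \<Rightarrow> real"
    using continuous_on_compose2[OF assms, of UNIV "\<lambda>q. (f q, g q)"] that
    by (simp add: continuous_intros)
  have "continuous_on (UNIV \<times> cbox 0 1) (\<lambda>(p, s). snd p * w (fst p) (snd p * s))"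
    by (rule continuous_on_subset[of UNIV])
      (auto simp: split_beta intro!: continuous_intros w)
  from integral_continuous_on_param[OF this] show ?thesis
    by (simp add: primitive_def split_beta)
qed

text \<open>
  A family of 1-forms with \<open>\<partial>\<^sub>t w = \<partial>\<^sub>y u\<close> is closed as a form on the cylinder, so the time derivative of
  its primitive along the circle is \<open>u\<close> up to a constant.
\<close>

lemma primitive_param_derivative:
  assumes deriv: "\<And>t y. ((\<lambda>t. w t y) has_real_derivative w' t y) (at t)"
    and u: "\<And>t y. ((\<lambda>y. u t y) has_real_derivative w' t y) (at y)"
    and w: "continuous_on UNIV (\<lambda>(t, y). w t y)"
    and w': "continuous_on UNIV (\<lambda>(t, y). w' t y)"
  shows "((\<lambda>t. primitive (w t) y) has_real_derivative u t y - u t 0) (at t)"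
proof -
  have "((\<lambda>t. integral (cbox 0 1) (\<lambda>s. y * w t (y * s))) has_field_derivative
          integral (cbox 0 1) (\<lambda>s. y * w' t (y * s))) (at t within UNIV)"
  proof (rule leibniz_rule_field_derivative)
    show "((\<lambda>t. y * w t (y * s)) has_real_derivative y * w' t (y * s)) (at t)" for t s
      by (auto intro!: derivative_eq_intros deriv)
    show "(\<lambda>s. y * w t (y * s)) integrable_on cbox 0 1" for t
      by (intro integrable_continuous continuous_intros
          continuous_on_compose2[OF w, of _ "\<lambda>s. (t, y * s)", simplified])
    show "continuous_on (UNIV \<times> cbox 0 1) (\<lambda>(t, s). y * w' t (y * s))"
      unfolding split_beta
      by (intro continuous_intros
          continuous_on_compose2[OF w', of _ "\<lambda>p. (fst p, y * snd p)", simplified])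
  qed auto
  moreover have "integral {0..1} (\<lambda>s. y * w' t (y * s)) = u t y - u t 0"
    using primitive_eq[of "u t" "w' t" y, OF u] by (simp add: primitive_def)
  ultimately show ?thesis by (simp add: primitive_def)
qed

text \<open>
  The iterated integral of two 1-forms over the pairs of points that are in order when the circle
  is cut at 0. The base point is immaterial once both forms have integral zero.
\<close>

definition cup :: "(real \<Rightarrow> real) \<Rightarrow> (real \<Rightarrow> real) \<Rightarrow> real" where
  "cup w1 w2 = circle_integral (\<lambda>y. primitive w1 y * w2 y)"

text \<open>
  The forms \<open>w\<^sub>i dy + u\<^sub>i dt\<close> are closed on the cylinder. If \<open>v\<close> is a primitive of the first one, the
  difference of two values of the iterated integral is the integral of
  \<open>d(v (w\<^sub>2 dy + u\<^sub>2 dt)) = (w\<^sub>1 dy + u\<^sub>1 dt) \<and> (w\<^sub>2 dy + u\<^sub>2 dt)\<close> over the cylinder, up to sign. The two conditions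
  on the integrals make \<open>v\<close> periodic and remove the dependence on the base point.
\<close>

lemma cup_has_derivative:
  assumes d1: "\<And>t y. ((\<lambda>t. w1 t y) has_real_derivative w1' t y) (at t)"
    and u1: "\<And>t y. ((\<lambda>y. u1 t y) has_real_derivative w1' t y) (at y)"
    and d2: "\<And>t y. ((\<lambda>t. w2 t y) has_real_derivative w2' t y) (at t)"
    and u2: "\<And>t y. ((\<lambda>y. u2 t y) has_real_derivative w2' t y) (at y)"
    and cont: "continuous_on UNIV (\<lambda>(t, y). w1 t y)" "continuous_on UNIV (\<lambda>(t, y). w1' t y)"
      "continuous_on UNIV (\<lambda>(t, y). w2 t y)" "continuous_on UNIV (\<lambda>(t, y). w2' t y)"
      "continuous_on UNIV (\<lambda>(t, y). u1 t y)" "continuous_on UNIV (\<lambda>(t, y). u2 t y)"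
    and zero: "\<And>t. circle_integral (w1 t) = 0" "\<And>t. circle_integral (w2 t) = 0"
  shows "((\<lambda>t. cup (w1 t) (w2 t)) has_real_derivative circle_integral (\<lambda>y. u1 t y * w2 t y - w1 t y * u2 t y)) (at t)"
proof -
  have 2: "continuous_on UNIV (\<lambda>q. f (g q) (h q))"
    if "continuous_on UNIV (\<lambda>(t, y). f t y)" "continuous_on UNIV g" "continuous_on UNIV h"
    for f :: "real \<Rightarrow> real \<Rightarrow> real" and g h :: "'c::topological_space \<Rightarrow> real"
    using continuous_on_compose2[OF that(1), of UNIV "\<lambda>q. (g q, h q)"] that(2,3)
    by (simp add: continuous_intros)
  note ci = 2[OF cont(1)] 2[OF cont(2)] 2[OF cont(3)] 2[OF cont(4)] 2[OF cont(5)] 2[OF cont(6)]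
    2[OF continuous_on_primitive[OF cont(1)]]
  have w1c: "continuous_on UNIV (w1 t)" for t
    using ci(1)[of "\<lambda>_. t" "\<lambda>y. y"] by simp
  let ?D = "\<lambda>t y. (u1 t y - u1 t 0) * w2 t y + primitive (w1 t) y * w2' t y"
  have "((\<lambda>t. cup (w1 t) (w2 t)) has_real_derivative circle_integral (?D t)) (at t)"
    unfolding cup_def
  proof (rule circ_has_derivative)
    show "((\<lambda>t. primitive (w1 t) x * w2 t x) has_real_derivative ?D t x) (at t)" for t x
      by (rule derivative_eq_intros primitive_param_derivative[OF d1 u1 cont(1,2)] d2)+ simp
  qed (auto simp: split_beta intro!: continuous_intros ci)
  moreover have "circle_integral (?D t) = circle_integral (\<lambda>y. u1 t y * w2 t y - w1 t y * u2 t y)"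
  proof -
    have "((\<lambda>y. primitive (w1 t) y * u2 t y) has_real_derivative
          (primitive (w1 t) y * w2' t y + w1 t y * u2 t y)) (at y)" for y
      by (rule derivative_eq_intros primitive_has_derivative w1c u2)+ simp
    from circ_derivative[OF this]
    have "circle_integral (\<lambda>y. primitive (w1 t) y * w2' t y + w1 t y * u2 t y) = 0"
      by (simp add: primitive_period w1c zero)
    moreover have "circle_integral (\<lambda>y. u1 t 0 * w2 t y) = 0"
      by (simp add: circ_cmult zero)
    moreover have "circle_integral (?D t) = circle_integral (\<lambda>y. ((u1 t y * w2 t y - w1 t y * u2 t y) - u1 t 0 * w2 t y) +
        (primitive (w1 t) y * w2' t y + w1 t y * u2 t y))"
      by (rule circ_cong) (simp add: algebra_simps)
    moreover have "\<dots> = circle_integral (\<lambda>y. u1 t y * w2 t y - w1 t y * u2 t y) - circle_integral (\<lambda>y. u1 t 0 * w2 t y)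
      + circle_integral (\<lambda>y. primitive (w1 t) y * w2' t y + w1 t y * u2 t y)"
      by (subst circ_add circ_diff; (intro continuous_intros ci)?)+ simp
    ultimately show ?thesis by simp
  qed
  ultimately show ?thesis by simp
qed

section \<open>Integrals over the three-torus\<close>

definition torus_integral :: "(real \<Rightarrow> real \<Rightarrow> real \<Rightarrow> real) \<Rightarrow> real" where
  "torus_integral f = circle_integral (\<lambda>x. circle_integral (\<lambda>y. circle_integral (\<lambda>z. f x y z)))"

lemma continuous_on_slice3:
  assumes "continuous_on UNIV (\<lambda>(x, y, z). f x y z)"
    "continuous_on A g" "continuous_on A h" "continuous_on A k"
  shows "continuous_on A (\<lambda>q. f (g q) (h q) (k q))"
  using continuous_on_compose2[OF assms(1), of A "\<lambda>q. (g q, h q, k q)"] assms(2-)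
  by (simp add: continuous_intros)

lemma continuous_on_slice2:
  assumes "continuous_on UNIV (\<lambda>(x, y). f x y)" "continuous_on A g" "continuous_on A h"
  shows "continuous_on A (\<lambda>q. f (g q) (h q))"
  using continuous_on_compose2[OF assms(1), of A "\<lambda>q. (g q, h q)"] assms(2-)
  by (simp add: continuous_intros)

lemma continuous_on_slice4:
  assumes "continuous_on UNIV (\<lambda>(t, x, y, z). f t x y z)"
    "continuous_on A j" "continuous_on A g" "continuous_on A h" "continuous_on A k"
  shows "continuous_on A (\<lambda>q. f (j q) (g q) (h q) (k q))"
  using continuous_on_compose2[OF assms(1), of A "\<lambda>q. (j q, g q, h q, k q)"] assms(2-)
  by (simp add: continuous_intros)

lemma continuous_on_circ1:
  fixes f :: "'a::topological_space \<Rightarrow> 'b::topological_space \<Rightarrow> real \<Rightarrow> real"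
  assumes "continuous_on UNIV (\<lambda>(p, q, x). f p q x)"
  shows "continuous_on UNIV (\<lambda>(p, q). circle_integral (f p q))"
  unfolding split_beta
  by (rule continuous_on_circ)
    (auto simp: split_beta intro!: continuous_on_slice3[OF assms] continuous_intros)

lemma continuous_on_circ2:
  fixes f :: "'a::topological_space \<Rightarrow> 'b::topological_space \<Rightarrow> 'c::topological_space \<Rightarrow> real \<Rightarrow> real"
  assumes "continuous_on UNIV (\<lambda>(p, q, r, x). f p q r x)"
  shows "continuous_on UNIV (\<lambda>(p, q, r). circle_integral (f p q r))"
  unfolding split_beta
  by (rule continuous_on_circ)
    (auto simp: split_beta intro!: continuous_on_slice4[OF assms] continuous_intros)

lemma torus_swap_12:
  assumes "continuous_on UNIV (\<lambda>(x, y, z). f x y z)"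
  shows "circle_integral (\<lambda>y. circle_integral (\<lambda>x. circle_integral (\<lambda>z. f x y z))) = torus_integral f"
  unfolding torus_integral_def by (rule circ_swap[symmetric]) (rule continuous_on_circ1[OF assms])

lemma torus_swap_23:
  assumes "continuous_on UNIV (\<lambda>(x, y, z). f x y z)"
  shows "circle_integral (\<lambda>x. circle_integral (\<lambda>z. circle_integral (\<lambda>y. f x y z))) = torus_integral f"
  unfolding torus_integral_def
  by (intro circ_cong circ_swap[symmetric])
    (auto simp: split_beta intro!: continuous_on_slice3[OF assms] continuous_intros)

lemma torus_cycle:
  assumes "continuous_on UNIV (\<lambda>(x, y, z). f x y z)"
  shows "circle_integral (\<lambda>z. circle_integral (\<lambda>x. circle_integral (\<lambda>y. f x y z))) = torus_integral f"
proof -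
  have "circle_integral (\<lambda>z. circle_integral (\<lambda>x. circle_integral (\<lambda>y. f x y z))) = circle_integral (\<lambda>x. circle_integral (\<lambda>z. circle_integral (\<lambda>y. f x y z)))"
    by (rule torus_swap_12[where f="\<lambda>x z y. f x y z", unfolded torus_integral_def])
      (auto simp: split_beta intro!: continuous_on_slice3[OF assms] continuous_intros)
  then show ?thesis by (simp add: torus_swap_23[OF assms])
qed

lemma torus_reverse:
  assumes "continuous_on UNIV (\<lambda>(x, y, z). f x y z)"
  shows "torus_integral (\<lambda>z y x. f x y z) = torus_integral f"
proof -
  have "torus_integral (\<lambda>z y x. f x y z) = circle_integral (\<lambda>z. circle_integral (\<lambda>x. circle_integral (\<lambda>y. f x y z)))"
    by (rule torus_swap_23[where f="\<lambda>z y x. f x y z", symmetric])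
      (auto simp: split_beta intro!: continuous_on_slice3[OF assms] continuous_intros)
  then show ?thesis by (simp add: torus_cycle[OF assms])
qed

lemma torus_zero [simp]: "torus_integral (\<lambda>x y z. 0) = 0"
  by (simp add: torus_integral_def)

lemma torus_cong: "(\<And>x y z. f x y z = g x y z) \<Longrightarrow> torus_integral f = torus_integral g"
  unfolding torus_integral_def by (intro circ_cong)

lemma torus_cmult: "torus_integral (\<lambda>x y z. c * f x y z) = c * torus_integral f"
  by (simp add: torus_integral_def circ_cmult)

lemma torus_add:
  assumes f: "continuous_on UNIV (\<lambda>(x, y, z). f x y z)" and g: "continuous_on UNIV (\<lambda>(x, y, z). g x y z)"
  shows "torus_integral (\<lambda>x y z. f x y z + g x y z) = torus_integral f + torus_integral g"
proof -
  note c1 = continuous_on_slice3[OF f] continuous_on_slice3[OF g]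
  note c2 = continuous_on_slice2[OF continuous_on_circ1[OF f]] continuous_on_slice2[OF continuous_on_circ1[OF g]]
  note c3 = continuous_on_circ[OF continuous_on_circ1[OF f]] continuous_on_circ[OF continuous_on_circ1[OF g]]
  have "circle_integral (\<lambda>z. f x y z + g x y z) = circle_integral (f x y) + circle_integral (g x y)" for x y
    by (intro circ_add c1 continuous_intros)
  moreover have "circle_integral (\<lambda>y. circle_integral (f x y) + circle_integral (g x y)) = circle_integral (\<lambda>y. circle_integral (f x y)) + circle_integral (\<lambda>y. circle_integral (g x y))" for x
    by (intro circ_add c2 continuous_intros)
  moreover have "circle_integral (\<lambda>x. circle_integral (\<lambda>y. circle_integral (f x y)) + circle_integral (\<lambda>y. circle_integral (g x y))) = torus_integral f + torus_integral g"
    unfolding torus_integral_def by (intro circ_add c3)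
  ultimately show ?thesis by (simp add: torus_integral_def)
qed

lemma torus_diff:
  assumes f: "continuous_on UNIV (\<lambda>(x, y, z). f x y z)" and g: "continuous_on UNIV (\<lambda>(x, y, z). g x y z)"
  shows "torus_integral (\<lambda>x y z. f x y z - g x y z) = torus_integral f - torus_integral g"
proof -
  have "continuous_on UNIV (\<lambda>(x, y, z). (-1) * g x y z)"
    using g by (auto simp: split_beta intro!: continuous_intros)
  from torus_add[OF f this] torus_cmult[of "-1" g] show ?thesis by simp
qed

lemma torus_has_derivative:
  assumes deriv: "\<And>t x y z. ((\<lambda>t. f t x y z) has_real_derivative f' t x y z) (at t)"
    and f: "continuous_on UNIV (\<lambda>(t, x, y, z). f t x y z)"
    and f': "continuous_on UNIV (\<lambda>(t, x, y, z). f' t x y z)"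
  shows "((\<lambda>t. torus_integral (f t)) has_real_derivative torus_integral (f' t)) (at t)"
  unfolding torus_integral_def
proof (intro circ_has_derivative)
  show "continuous_on UNIV (\<lambda>(t, x). circle_integral (\<lambda>y. circle_integral (f t x y)))"
    by (intro continuous_on_circ1 continuous_on_circ2 f)
  show "continuous_on UNIV (\<lambda>(t, x). circle_integral (\<lambda>y. circle_integral (f' t x y)))"
    by (intro continuous_on_circ1 continuous_on_circ2 f')
qed (auto simp: split_beta deriv intro!: continuous_intros continuous_on_slice4[OF f] continuous_on_slice4[OF f']
    continuous_on_slice3[OF continuous_on_circ2[OF f]] continuous_on_slice3[OF continuous_on_circ2[OF f']])

text \<open>
  Stokes' theorem on the closed torus: a divergence integrates to zero.
\<close>

lemma torus_boundary:
  assumes fx: "\<And>x y z. ((\<lambda>x. f x y z) has_real_derivative fx x y z) (at x)"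
    and gy: "\<And>x y z. ((\<lambda>y. g x y z) has_real_derivative gy x y z) (at y)"
    and hz: "\<And>x y z. ((\<lambda>z. h x y z) has_real_derivative hz x y z) (at z)"
    and f: "\<And>y z. f (2 * pi) y z = f 0 y z"
    and g: "\<And>x z. g x (2 * pi) z = g x 0 z"
    and h: "\<And>x y. h x y (2 * pi) = h x y 0"
    and c: "continuous_on UNIV (\<lambda>(x, y, z). fx x y z)" "continuous_on UNIV (\<lambda>(x, y, z). gy x y z)"
      "continuous_on UNIV (\<lambda>(x, y, z). hz x y z)"
  shows "torus_integral (\<lambda>x y z. fx x y z + gy x y z + hz x y z) = 0"
proof -
  have "torus_integral fx = circle_integral (\<lambda>y. circle_integral (\<lambda>z. circle_integral (\<lambda>x. fx x y z)))"
  proof -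
    have "torus_integral fx = circle_integral (\<lambda>y. circle_integral (\<lambda>x. circle_integral (\<lambda>z. fx x y z)))"
      by (rule torus_swap_12[OF c(1), symmetric])
    also have "\<dots> = circle_integral (\<lambda>y. circle_integral (\<lambda>z. circle_integral (\<lambda>x. fx x y z)))"
      by (intro circ_cong circ_swap)
        (auto simp: split_beta intro!: continuous_intros continuous_on_slice3[OF c(1)])
    finally show ?thesis .
  qed
  also have "\<dots> = 0"
    by (simp add: circ_derivative[OF fx] f)
  finally have 1: "torus_integral fx = 0" .
  have "torus_integral gy = 0"
    by (simp add: torus_swap_23[OF c(2), symmetric] circ_derivative[OF gy] g)
  moreover have "torus_integral hz = 0"
    by (simp add: torus_integral_def circ_derivative[OF hz] h)
  moreover have "continuous_on UNIV (\<lambda>(x, y, z). fx x y z + gy x y z)"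
    using c(1,2) by (auto simp: split_beta intro!: continuous_intros)
  ultimately show ?thesis
    using 1 c by (simp add: torus_add)
qed

text \<open>
  In the next three lemmas two crossings share one component, and the integral over the common angle
  becomes an integral over the three-torus.
\<close>

lemma torus_common_1:
  "circle_integral (\<lambda>x. circle_integral (\<lambda>y. f x y) * circle_integral (\<lambda>z. g x z)) = torus_integral (\<lambda>x y z. f x y * g x z)"
  by (simp add: torus_integral_def circ_cmult circ_multc)

lemma torus_common_2:
  assumes "continuous_on UNIV (\<lambda>(x, y). f x y)" "continuous_on UNIV (\<lambda>(y, z). g y z)"
  shows "circle_integral (\<lambda>y. circle_integral (\<lambda>x. f x y) * circle_integral (\<lambda>z. g y z)) = torus_integral (\<lambda>x y z. f x y * g y z)"
proof -
  have "circle_integral (\<lambda>y. circle_integral (\<lambda>x. f x y) * circle_integral (\<lambda>z. g y z)) = circle_integral (\<lambda>y. circle_integral (\<lambda>x. circle_integral (\<lambda>z. f x y * g y z)))"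
    by (simp add: circ_cmult circ_multc)
  also have "\<dots> = torus_integral (\<lambda>x y z. f x y * g y z)"
    by (rule torus_swap_12)
      (auto simp: split_beta intro!: continuous_intros assms[THEN continuous_on_slice2])
  finally show ?thesis .
qed

lemma torus_common_3:
  assumes "continuous_on UNIV (\<lambda>(x, z). f x z)" "continuous_on UNIV (\<lambda>(y, z). g y z)"
  shows "circle_integral (\<lambda>z. circle_integral (\<lambda>x. f x z) * circle_integral (\<lambda>y. g y z)) = torus_integral (\<lambda>x y z. f x z * g y z)"
proof -
  have "circle_integral (\<lambda>z. circle_integral (\<lambda>x. f x z) * circle_integral (\<lambda>y. g y z)) = circle_integral (\<lambda>z. circle_integral (\<lambda>x. circle_integral (\<lambda>y. f x z * g y z)))"
    by (simp add: circ_cmult circ_multc)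
  also have "\<dots> = torus_integral (\<lambda>x y z. f x z * g y z)"
    by (rule torus_cycle)
      (auto simp: split_beta intro!: continuous_intros assms[THEN continuous_on_slice2])
  finally show ?thesis .
qed

section \<open>Closed forms on pairs of moving curves\<close>

lemma vec_nth_has_derivative:
  assumes "(u has_vector_derivative u') (at s)"
  shows "((\<lambda>s. u s $ n) has_real_derivative u' $ n) (at s)"
  using bounded_linear.has_vector_derivative[OF bounded_linear_vec_nth assms]
  by (simp add: has_real_derivative_iff_has_vector_derivative)

text \<open>
  The value of \<open>dX \<and> dY\<close> on two vectors.
\<close>

definition planar_cross :: "real^3 \<Rightarrow> real^3 \<Rightarrow> real" where
  "planar_cross u v = u $ 1 * v $ 2 - u $ 2 * v $ 1"

lemma planar_cross_has_derivative:
  assumes "(u has_vector_derivative u') (at s)" "(v has_vector_derivative v') (at s)"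
  shows "((\<lambda>s. planar_cross (u s) (v s)) has_real_derivative planar_cross u' (v s) + planar_cross (u s) v') (at s)"
proof -
  note c = vec_nth_has_derivative
  show ?thesis
    unfolding planar_cross_def
    using DERIV_diff[OF DERIV_mult[OF c[OF assms(1), of 1] c[OF assms(2), of 2]]
        DERIV_mult[OF c[OF assms(1), of 2] c[OF assms(2), of 1]]]
    by (rule DERIV_cong) (simp add: algebra_simps)
qed

lemma continuous_on_planar_cross [continuous_intros]:
  assumes "continuous_on A f" "continuous_on A g"
  shows "continuous_on A (\<lambda>q. planar_cross (f q) (g q))"
  unfolding planar_cross_def by (intro continuous_intros assms)

text \<open>
  A motion of a closed curve for all real times. The exterior derivative of a form made from first
  derivatives contains second derivatives only through the mixed one, whence \<open>Ftx\<close>.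
\<close>

locale moving_curve =
  fixes F Ft Fx Ftx :: "real \<Rightarrow> real \<Rightarrow> real^3"
  assumes F_x: "((\<lambda>x. F t x) has_vector_derivative Fx t x) (at x)"
    and F_t: "((\<lambda>t. F t x) has_vector_derivative Ft t x) (at t)"
    and Fx_t: "((\<lambda>t. Fx t x) has_vector_derivative Ftx t x) (at t)"
    and Ft_x: "((\<lambda>x. Ft t x) has_vector_derivative Ftx t x) (at x)"
    and continuous:
      "continuous_on UNIV (\<lambda>(t, x). F t x)" "continuous_on UNIV (\<lambda>(t, x). Ft t x)"
      "continuous_on UNIV (\<lambda>(t, x). Fx t x)" "continuous_on UNIV (\<lambda>(t, x). Ftx t x)"
    and periodic: "F t (2 * pi) = F t 0" "Ft t (2 * pi) = Ft t 0" "Fx t (2 * pi) = Fx t 0"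
begin

lemmas continuous_curve [continuous_intros] =
  continuous_on_slice2[OF continuous(1)] continuous_on_slice2[OF continuous(2)]
  continuous_on_slice2[OF continuous(3)] continuous_on_slice2[OF continuous(4)]

lemma tangent: "vector_derivative (F t) (at x) = Fx t x"
  by (rule vector_derivative_at[OF F_x])

end

text \<open>
  The two curves carry the 2-form \<open>g(p) dp\<^sub>1 \<and> dp\<^sub>2\<close> with \<open>p = B - A\<close>. The hypothesis on the derivative
  of \<open>g\<close> says that it does not depend on the third coordinate near any value of \<open>p\<close> that occurs, so that the
  form is closed on the product of the time axis and the torus.
\<close>

locale moving_pair = A: moving_curve A At Ax Atx + B: moving_curve B Bt Bx Btx
  for A At Ax Atx B Bt Bx Btx +
  fixes g \<alpha> \<beta> :: "real^3 \<Rightarrow> real"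
  assumes g_deriv: "(g has_derivative (\<lambda>h. \<alpha> (B t y - A t x) * h $ 1 + \<beta> (B t y - A t x) * h $ 2))
      (at (B t y - A t x))"
    and g_continuous: "continuous_on UNIV g" "continuous_on UNIV \<alpha>" "continuous_on UNIV \<beta>"
begin

lemmas continuous_g [continuous_intros] =
  continuous_on_compose2[OF g_continuous(1) _ subset_UNIV]
  continuous_on_compose2[OF g_continuous(2) _ subset_UNIV]
  continuous_on_compose2[OF g_continuous(3) _ subset_UNIV]

text \<open>
  The coefficient of \<open>dx \<and> dy\<close>; \<open>flux_x\<close> and \<open>flux_y\<close> are those of \<open>dt \<and> dy\<close> and of \<open>dt \<and> dx\<close>.
\<close>

definition dens where
  "dens t x y = g (B t y - A t x) * planar_cross (- Ax t x) (Bx t y)"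

definition flux_x where
  "flux_x t x y = g (B t y - A t x) * planar_cross (Bt t y - At t x) (Bx t y)"

definition flux_y where
  "flux_y t x y = g (B t y - A t x) * planar_cross (Bt t y - At t x) (- Ax t x)"

definition dg :: "real \<Rightarrow> real \<Rightarrow> real \<Rightarrow> real^3 \<Rightarrow> real" where
  "dg t x y h = \<alpha> (B t y - A t x) * h $ 1 + \<beta> (B t y - A t x) * h $ 2"

definition flux_xx where
  "flux_xx t x y = dg t x y (- Ax t x) * planar_cross (Bt t y - At t x) (Bx t y)
    + g (B t y - A t x) * planar_cross (- Atx t x) (Bx t y)"

definition flux_yy where
  "flux_yy t x y = dg t x y (Bx t y) * planar_cross (Bt t y - At t x) (- Ax t x)
    + g (B t y - A t x) * planar_cross (Btx t y) (- Ax t x)"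

lemma g_has_derivative:
  assumes "p s = B t y - A t x" "(p has_vector_derivative h) (at s)"
  shows "((\<lambda>s. g (p s)) has_real_derivative dg t x y h) (at s)"
proof -
  have "((\<lambda>s. g (p s)) has_derivative (\<lambda>k. dg t x y (k *\<^sub>R h))) (at s)"
    using has_derivative_compose[OF assms(2)[unfolded has_vector_derivative_def],
        OF g_deriv[of t y x, folded assms(1)]] unfolding dg_def assms(1) .
  moreover have "(\<lambda>k. dg t x y (k *\<^sub>R h)) = (*) (dg t x y h)"
    by (auto simp: dg_def algebra_simps)
  ultimately show ?thesis by (simp add: has_field_derivative_def)
qed

lemma flux_x_has_derivative: "((\<lambda>x. flux_x t x y) has_real_derivative flux_xx t x y) (at x)"
proof -
  have 1: "((\<lambda>x. B t y - A t x) has_vector_derivative - Ax t x) (at x)"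
    by (auto intro!: derivative_eq_intros A.F_x)
  have 2: "((\<lambda>x. Bt t y - At t x) has_vector_derivative - Atx t x) (at x)"
    by (auto intro!: derivative_eq_intros A.Ft_x)
  show ?thesis
    unfolding flux_x_def flux_xx_def
    by (rule DERIV_cong, rule DERIV_mult[OF g_has_derivative[OF refl 1]
        planar_cross_has_derivative[OF 2 has_vector_derivative_const]])
      (simp add: planar_cross_def)
qed

lemma flux_y_has_derivative: "((\<lambda>y. flux_y t x y) has_real_derivative flux_yy t x y) (at y)"
proof -
  have 1: "((\<lambda>y. B t y - A t x) has_vector_derivative Bx t y) (at y)"
    by (auto intro!: derivative_eq_intros B.F_x)
  have 2: "((\<lambda>y. Bt t y - At t x) has_vector_derivative Btx t y) (at y)"
    by (auto intro!: derivative_eq_intros B.Ft_x)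
  show ?thesis
    unfolding flux_y_def flux_yy_def
    by (rule DERIV_cong, rule DERIV_mult[OF g_has_derivative[OF refl 1]
        planar_cross_has_derivative[OF 2 has_vector_derivative_const]])
      (simp add: planar_cross_def)
qed

text \<open>
  The form is closed. The mixed second derivatives cancel, and so do the terms with the derivatives
  of \<open>g\<close>, because \<open>dg\<close> is a combination of \<open>dp\<^sub>1\<close> and \<open>dp\<^sub>2\<close>.
\<close>

lemma dens_has_derivative:
  "((\<lambda>t. dens t x y) has_real_derivative flux_xx t x y - flux_yy t x y) (at t)"
proof -
  have 1: "((\<lambda>t. B t y - A t x) has_vector_derivative Bt t y - At t x) (at t)"
    by (auto intro!: derivative_eq_intros A.F_t B.F_t)
  have 2: "((\<lambda>t. - Ax t x) has_vector_derivative - Atx t x) (at t)"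
    by (auto intro!: derivative_eq_intros A.Fx_t)
  show ?thesis
    unfolding dens_def flux_xx_def flux_yy_def
    by (rule DERIV_cong, rule DERIV_mult[OF g_has_derivative[OF refl 1]
        planar_cross_has_derivative[OF 2 B.Fx_t]])
      (simp add: planar_cross_def dg_def algebra_simps)
qed

lemma continuous_pair:
  "continuous_on UNIV (\<lambda>(t, x, y). dens t x y)"
  "continuous_on UNIV (\<lambda>(t, x, y). flux_x t x y)"
  "continuous_on UNIV (\<lambda>(t, x, y). flux_y t x y)"
  "continuous_on UNIV (\<lambda>(t, x, y). flux_xx t x y)"
  "continuous_on UNIV (\<lambda>(t, x, y). flux_yy t x y)"
  unfolding dens_def flux_x_def flux_y_def flux_xx_def flux_yy_def dg_def split_beta
  by (intro continuous_intros)+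

lemmas continuous_slice [continuous_intros] = continuous_pair[THEN continuous_on_slice3]

lemma flux_xx_circ: "circle_integral (\<lambda>x. flux_xx t x y) = 0"
  by (simp add: circ_derivative[OF flux_x_has_derivative] flux_x_def A.periodic)

lemma flux_yy_circ: "circle_integral (\<lambda>y. flux_yy t x y) = 0"
  by (simp add: circ_derivative[OF flux_y_has_derivative] flux_y_def B.periodic)

text \<open>
  Integrating the closed 2-form over one of its two circles leaves a closed 1-form on the cylinder of
  the other. The \<open>dens\<close> and \<open>flux\<close> parts are its components, with the common derivative marked by a prime.
  The minus signs for the second curve come from the orientation of \<open>dx \<and> dy\<close>.
\<close>

definition first_dens where "first_dens t x = circle_integral (\<lambda>y. dens t x y)"
definition first_flux where "first_flux t x = circle_integral (\<lambda>y. flux_x t x y)"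
definition first_dens' where "first_dens' t x = circle_integral (\<lambda>y. flux_xx t x y)"
definition second_dens where "second_dens t y = circle_integral (\<lambda>x. dens t x y)"
definition second_flux where "second_flux t y = circle_integral (\<lambda>x. - flux_y t x y)"
definition second_dens' where "second_dens' t y = circle_integral (\<lambda>x. - flux_yy t x y)"

lemma first_dens_has_derivative:
  "((\<lambda>t. first_dens t x) has_real_derivative first_dens' t x) (at t)"
proof -
  have "((\<lambda>t. first_dens t x) has_real_derivative circle_integral (\<lambda>y. flux_xx t x y - flux_yy t x y)) (at t)"
    unfolding first_dens_def
    by (rule circ_has_derivative[OF dens_has_derivative])
      (auto simp: split_beta intro!: continuous_intros)
  also have "circle_integral (\<lambda>y. flux_xx t x y - flux_yy t x y) = first_dens' t x"
    by (subst circ_diff) (auto simp: first_dens'_def flux_yy_circ intro!: continuous_intros)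
  finally show ?thesis .
qed

lemma second_dens_has_derivative:
  "((\<lambda>t. second_dens t y) has_real_derivative second_dens' t y) (at t)"
proof -
  have "((\<lambda>t. second_dens t y) has_real_derivative circle_integral (\<lambda>x. flux_xx t x y - flux_yy t x y)) (at t)"
    unfolding second_dens_def
    by (rule circ_has_derivative[OF dens_has_derivative])
      (auto simp: split_beta intro!: continuous_intros)
  also have "circle_integral (\<lambda>x. flux_xx t x y - flux_yy t x y) = second_dens' t y"
    by (subst circ_diff)
      (auto simp: second_dens'_def flux_xx_circ circ_uminus intro!: continuous_intros)
  finally show ?thesis .
qed

lemma first_flux_has_derivative:
  "((\<lambda>x. first_flux t x) has_real_derivative first_dens' t x) (at x)"
  unfolding first_flux_def first_dens'_def
  by (rule circ_has_derivative[OF flux_x_has_derivative])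
    (auto simp: split_beta intro!: continuous_intros)

lemma second_flux_has_derivative:
  "((\<lambda>y. second_flux t y) has_real_derivative second_dens' t y) (at y)"
  unfolding second_flux_def second_dens'_def
  by (rule circ_has_derivative[OF DERIV_minus[OF flux_y_has_derivative]])
    (auto simp: split_beta intro!: continuous_intros)

lemma continuous_marginal:
  "continuous_on UNIV (\<lambda>(t, x). first_dens t x)" "continuous_on UNIV (\<lambda>(t, x). first_flux t x)"
  "continuous_on UNIV (\<lambda>(t, x). first_dens' t x)" "continuous_on UNIV (\<lambda>(t, y). second_dens t y)"
  "continuous_on UNIV (\<lambda>(t, y). second_flux t y)" "continuous_on UNIV (\<lambda>(t, y). second_dens' t y)"
  unfolding first_dens_def first_flux_def first_dens'_def second_dens_def second_flux_def second_dens'_def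
  by (rule continuous_on_circ1, (unfold split_beta)[1], (intro continuous_intros)[1])+

definition total where "total t = circle_integral (first_dens t)"

lemma total_eq: "circle_integral (second_dens t) = total t"
  unfolding total_def first_dens_def second_dens_def
  by (rule circ_swap[symmetric]) (auto simp: split_beta intro!: continuous_intros)

text \<open>
  By closedness the time derivative is the integral over a circle of the derivative of a periodic function.
\<close>

lemma total_constant: "total s = total t"
proof -
  have "(total has_real_derivative 0) (at t)" for t
  proof -
    have "(total has_real_derivative circle_integral (first_dens' t)) (at t)"
      unfolding total_def
      by (rule circ_has_derivative[OF first_dens_has_derivative continuous_marginal(1,3)])
    moreover have "circle_integral (first_dens' t) = 0"
      by (simp add: circ_derivative[OF first_flux_has_derivative] first_flux_def flux_x_def A.periodic)
    ultimately show ?thesis by simp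
  qed
  then show ?thesis by (intro DERIV_isconst_all allI)
qed

end

section \<open>Exact forms on triples of moving curves\<close>

text \<open>
  For \<open>j = 1\<close> and \<open>i = 2\<close> this is \<open>planar_cross\<close>, and for \<open>j = 2\<close> and \<open>i = 1\<close> its negative.
\<close>

definition minor :: "3 \<Rightarrow> 3 \<Rightarrow> real^3 \<Rightarrow> real^3 \<Rightarrow> real" where
  "minor j i u v = u $ j * v $ i - u $ i * v $ j"

lemma continuous_on_minor [continuous_intros]:
  assumes "continuous_on A f" "continuous_on A g"
  shows "continuous_on A (\<lambda>q. minor j i (f q) (g q))"
  unfolding minor_def by (intro continuous_intros assms)

text \<open>
  For \<open>p = B - A\<close> and \<open>q = C - B\<close> the three curves carry the 3-form \<open>G(p, q) dp\<^sub>1 \<and> dp\<^sub>2 \<and> dq\<^sub>i\<close>. Since the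
  derivative of \<open>G\<close> involves only planar coordinates, only its \<open>dq\<^sub>j\<close> part survives
  in the exterior derivative, which is \<open>\<gamma>(p, q) dq\<^sub>j \<and> dp\<^sub>1 \<and> dp\<^sub>2 \<and> dq\<^sub>i\<close>.
\<close>

locale moving_triple =
  A: moving_curve A At Ax Atx + B: moving_curve B Bt Bx Btx + C: moving_curve C Ct Cx Ctx
  for A At Ax Atx B Bt Bx Btx C Ct Cx Ctx +
  fixes G \<alpha> \<beta> \<gamma> \<delta> :: "real^3 \<Rightarrow> real^3 \<Rightarrow> real" and i j :: 3
  assumes G_deriv: "\<And>t x y z p q. p = B t y - A t x \<Longrightarrow> q = C t z - B t y \<Longrightarrow>
      ((\<lambda>r. G (fst r) (snd r)) has_derivative
        (\<lambda>h. \<alpha> p q * fst h $ 1 + \<beta> p q * fst h $ 2 + \<gamma> p q * snd h $ j + \<delta> p q * snd h $ i)) (at (p, q))"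
    and G_continuous: "continuous_on UNIV (\<lambda>(p, q). G p q)" "continuous_on UNIV (\<lambda>(p, q). \<alpha> p q)"
      "continuous_on UNIV (\<lambda>(p, q). \<beta> p q)" "continuous_on UNIV (\<lambda>(p, q). \<gamma> p q)"
      "continuous_on UNIV (\<lambda>(p, q). \<delta> p q)"
begin

lemmas continuous_G [continuous_intros] = G_continuous[THEN continuous_on_slice2]

text \<open>
  The coefficient of \<open>dx \<and> dy \<and> dz\<close> in the 3-form. Up to sign, the functions \<open>flux_x\<close>, \<open>flux_y\<close> and \<open>flux_z\<close>
  below are the three coefficients that involve \<open>dt\<close>.
\<close>

definition vol where
  "vol t x y z = G (B t y - A t x) (C t z - B t y) * (planar_cross (- Ax t x) (Bx t y) * Cx t z $ i)"

text \<open>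
  The Jacobian determinant of \<open>dp\<^sub>1 \<and> dp\<^sub>2 \<and> dq\<^sub>j \<and> dq\<^sub>i\<close> in the variables \<open>t, x, y, z\<close>, expanded along the
  pairs of columns.
\<close>

definition jac where
  "jac t x y z = planar_cross (- Ax t x) (Bx t y) * minor j i (Ct t z - Bt t y) (Cx t z)
     + planar_cross (Bt t y - At t x) (- Ax t x) * minor j i (- Bx t y) (Cx t z)"

definition dG :: "real \<Rightarrow> real \<Rightarrow> real \<Rightarrow> real \<Rightarrow> real^3 \<Rightarrow> real^3 \<Rightarrow> real" where
  "dG t x y z h k = (let p = B t y - A t x; q = C t z - B t y in
     \<alpha> p q * h $ 1 + \<beta> p q * h $ 2 + \<gamma> p q * k $ j + \<delta> p q * k $ i)"

lemma G_has_derivative: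
  assumes "p s = B t y - A t x" "q s = C t z - B t y"
    "(p has_vector_derivative h) (at s)" "(q has_vector_derivative k) (at s)"
  shows "((\<lambda>s. G (p s) (q s)) has_real_derivative dG t x y z h k) (at s)"
proof -
  have pq: "((\<lambda>s. (p s, q s)) has_derivative (\<lambda>c. (c *\<^sub>R h, c *\<^sub>R k))) (at s)"
    using assms(3,4) unfolding has_vector_derivative_def by (rule has_derivative_Pair)
  have "((\<lambda>s. G (p s) (q s)) has_derivative (\<lambda>c. dG t x y z (c *\<^sub>R h) (c *\<^sub>R k))) (at s)"
    using has_derivative_compose[OF pq, OF G_deriv[OF assms(1,2)]]
    unfolding dG_def Let_def assms(1,2) fst_conv snd_conv .
  moreover have "(\<lambda>c. dG t x y z (c *\<^sub>R h) (c *\<^sub>R k)) = (*) (dG t x y z h k)"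
    by (auto simp: dG_def Let_def algebra_simps)
  ultimately show ?thesis by (simp add: has_field_derivative_def)
qed

definition flux_x where
  "flux_x t x y z = G (B t y - A t x) (C t z - B t y) * (planar_cross (Bt t y - At t x) (Bx t y) * Cx t z $ i)"
definition flux_y where
  "flux_y t x y z = G (B t y - A t x) (C t z - B t y) * (planar_cross (- Ax t x) (Bt t y - At t x) * Cx t z $ i)"
definition flux_z where
  "flux_z t x y z = G (B t y - A t x) (C t z - B t y) *
     ((Ct t z - Bt t y) $ i * planar_cross (- Ax t x) (Bx t y) - Bx t y $ i * planar_cross (Bt t y - At t x) (- Ax t x))"

definition flux_xx where
  "flux_xx t x y z = dG t x y z (- Ax t x) 0 * (planar_cross (Bt t y - At t x) (Bx t y) * Cx t z $ i)
     + G (B t y - A t x) (C t z - B t y) * (planar_cross (- Atx t x) (Bx t y) * Cx t z $ i)"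
definition flux_yy where
  "flux_yy t x y z = dG t x y z (Bx t y) (- Bx t y) * (planar_cross (- Ax t x) (Bt t y - At t x) * Cx t z $ i)
     + G (B t y - A t x) (C t z - B t y) * (planar_cross (- Ax t x) (Btx t y) * Cx t z $ i)"
definition flux_zz where
  "flux_zz t x y z = dG t x y z 0 (Cx t z) *
       ((Ct t z - Bt t y) $ i * planar_cross (- Ax t x) (Bx t y) - Bx t y $ i * planar_cross (Bt t y - At t x) (- Ax t x))
     + G (B t y - A t x) (C t z - B t y) * (Ctx t z $ i * planar_cross (- Ax t x) (Bx t y))"

lemma flux_x_has_derivative: "((\<lambda>x. flux_x t x y z) has_real_derivative flux_xx t x y z) (at x)"
proof -
  have p: "((\<lambda>x. B t y - A t x) has_vector_derivative - Ax t x) (at x)"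
    by (auto intro!: derivative_eq_intros A.F_x)
  have r: "((\<lambda>x. Bt t y - At t x) has_vector_derivative - Atx t x) (at x)"
    by (auto intro!: derivative_eq_intros A.Ft_x)
  show ?thesis
    unfolding flux_x_def flux_xx_def
    by (rule DERIV_cong, rule DERIV_mult[OF G_has_derivative[OF refl refl p has_vector_derivative_const]
        DERIV_mult[OF planar_cross_has_derivative[OF r has_vector_derivative_const] DERIV_const]])
      (simp add: planar_cross_def)
qed

lemma flux_y_has_derivative: "((\<lambda>y. flux_y t x y z) has_real_derivative flux_yy t x y z) (at y)"
proof -
  have p: "((\<lambda>y. B t y - A t x) has_vector_derivative Bx t y) (at y)"
    by (auto intro!: derivative_eq_intros B.F_x)
  have q: "((\<lambda>y. C t z - B t y) has_vector_derivative - Bx t y) (at y)"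
    by (auto intro!: derivative_eq_intros B.F_x)
  have r: "((\<lambda>y. Bt t y - At t x) has_vector_derivative Btx t y) (at y)"
    by (auto intro!: derivative_eq_intros B.Ft_x)
  show ?thesis
    unfolding flux_y_def flux_yy_def
    by (rule DERIV_cong, rule DERIV_mult[OF G_has_derivative[OF refl refl p q]
        DERIV_mult[OF planar_cross_has_derivative[OF has_vector_derivative_const r] DERIV_const]])
      (simp add: planar_cross_def)
qed

lemma flux_z_has_derivative: "((\<lambda>z. flux_z t x y z) has_real_derivative flux_zz t x y z) (at z)"
proof -
  have q: "((\<lambda>z. C t z - B t y) has_vector_derivative Cx t z) (at z)"
    by (auto intro!: derivative_eq_intros C.F_x)
  have r: "((\<lambda>z. (Ct t z - Bt t y) $ i) has_real_derivative Ctx t z $ i) (at z)"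
    by (rule vec_nth_has_derivative) (auto intro!: derivative_eq_intros C.Ft_x)
  show ?thesis
    unfolding flux_z_def flux_zz_def
    by (rule DERIV_cong, rule DERIV_mult[OF G_has_derivative[OF refl refl has_vector_derivative_const q]
        DERIV_diff[OF DERIV_mult[OF r DERIV_const] DERIV_const]])
      simp
qed

text \<open>
  The exterior derivative of the 3-form, written as a time derivative and a divergence.
\<close>

lemma vol_has_derivative:
  "((\<lambda>t. vol t x y z) has_real_derivative
     \<gamma> (B t y - A t x) (C t z - B t y) * jac t x y z
     + (flux_xx t x y z + flux_yy t x y z + flux_zz t x y z)) (at t)"
proof -
  have p: "((\<lambda>t. B t y - A t x) has_vector_derivative Bt t y - At t x) (at t)"
    by (auto intro!: derivative_eq_intros A.F_t B.F_t)
  have q: "((\<lambda>t. C t z - B t y) has_vector_derivative Ct t z - Bt t y) (at t)"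
    by (auto intro!: derivative_eq_intros C.F_t B.F_t)
  have a: "((\<lambda>t. - Ax t x) has_vector_derivative - Atx t x) (at t)"
    by (auto intro!: derivative_eq_intros A.Fx_t)
  show ?thesis
    unfolding vol_def
    by (rule DERIV_cong, rule DERIV_mult[OF G_has_derivative[OF refl refl p q]
        DERIV_mult[OF planar_cross_has_derivative[OF a B.Fx_t] vec_nth_has_derivative[OF C.Fx_t]]])
      (simp add: flux_xx_def flux_yy_def flux_zz_def jac_def minor_def planar_cross_def dG_def Let_def algebra_simps)
qed

lemma continuous_triple:
  "continuous_on UNIV (\<lambda>(t, x, y, z). vol t x y z)"
  "continuous_on UNIV (\<lambda>(t, x, y, z). \<gamma> (B t y - A t x) (C t z - B t y) * jac t x y z)"
  "continuous_on UNIV (\<lambda>(t, x, y, z). flux_xx t x y z)"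
  "continuous_on UNIV (\<lambda>(t, x, y, z). flux_yy t x y z)"
  "continuous_on UNIV (\<lambda>(t, x, y, z). flux_zz t x y z)"
  unfolding vol_def jac_def flux_xx_def flux_yy_def flux_zz_def dG_def Let_def split_beta
  by (intro continuous_intros)+

lemmas continuous_triple_slice [continuous_intros] = continuous_triple[THEN continuous_on_slice4]

text \<open>
  By Stokes' theorem the integral of the 3-form over the three-torus changes by the integral of its
  exterior derivative.
\<close>

lemma torus_vol_has_derivative:
  "((\<lambda>t. torus_integral (vol t)) has_real_derivative
     torus_integral (\<lambda>x y z. \<gamma> (B t y - A t x) (C t z - B t y) * jac t x y z)) (at t)"
proof -
  have "((\<lambda>t. torus_integral (vol t)) has_real_derivative
     torus_integral (\<lambda>x y z. \<gamma> (B t y - A t x) (C t z - B t y) * jac t x y z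
       + (flux_xx t x y z + flux_yy t x y z + flux_zz t x y z))) (at t)"
    by (rule torus_has_derivative[OF vol_has_derivative])
      ((unfold split_beta)[1], (intro continuous_intros)[1])+
  also have "torus_integral (\<lambda>x y z. \<gamma> (B t y - A t x) (C t z - B t y) * jac t x y z
       + (flux_xx t x y z + flux_yy t x y z + flux_zz t x y z))
    = torus_integral (\<lambda>x y z. \<gamma> (B t y - A t x) (C t z - B t y) * jac t x y z)
      + torus_integral (\<lambda>x y z. flux_xx t x y z + flux_yy t x y z + flux_zz t x y z)"
    by (rule torus_add) ((unfold split_beta)[1], (intro continuous_intros)[1])+
  also have "torus_integral (\<lambda>x y z. flux_xx t x y z + flux_yy t x y z + flux_zz t x y z) = 0"
    by (rule torus_boundary[OF flux_x_has_derivative flux_y_has_derivative flux_z_has_derivative])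
      ((simp add: flux_x_def flux_y_def flux_z_def A.periodic B.periodic C.periodic)[1]
        | ((unfold split_beta)[1], (intro continuous_intros)[1]))+
  finally show ?thesis by simp
qed

end

section \<open>Smeared crossings and the triple linking number\<close>

text \<open>
  The bump is built from the square of the positive part, which is just smooth enough.
\<close>

lemma max_zero_square_deriv:
  "((\<lambda>v::real. (max 0 v)\<^sup>2) has_real_derivative 2 * max 0 v) (at v)"
proof -
  consider "v > 0" | "v < 0" | "v = 0" by linarith
  then show ?thesis
  proof cases
    case 1
    have "((\<lambda>v::real. v\<^sup>2) has_real_derivative 2 * v) (at v)"
      by (auto intro!: derivative_eq_intros)
    then have "((\<lambda>v::real. (max 0 v)\<^sup>2) has_real_derivative 2 * v) (at v)"
      by (rule has_field_derivative_transform_within_open[where S="{0<..}"]) (use 1 in auto)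
    with 1 show ?thesis by simp
  next
    case 2
    have "((\<lambda>v::real. 0) has_real_derivative 0) (at v)" by simp
    then have "((\<lambda>v::real. (max 0 v)\<^sup>2) has_real_derivative 0) (at v)"
      by (rule has_field_derivative_transform_within_open[where S="{..<0}"]) (use 2 in auto)
    with 2 show ?thesis by simp
  next
    case 3
    have "((\<lambda>h::real. max 0 h) \<longlongrightarrow> max 0 0) (at 0)"
      by (intro tendsto_intros)
    moreover have "\<forall>\<^sub>F h in at (0::real). max 0 h = ((max 0 (0 + h))\<^sup>2 - (max 0 0)\<^sup>2) / h"
      by (auto simp: eventually_at_filter max_def power2_eq_square)
    ultimately have "((\<lambda>h::real. ((max 0 (0 + h))\<^sup>2 - (max 0 0)\<^sup>2) / h) \<longlongrightarrow> max 0 0) (at 0)"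
      by (rule Lim_transform_eventually)
    then show ?thesis by (simp add: 3 DERIV_def)
  qed
qed

text \<open>
  \<open>S\<close> is a step function of width \<open>e\<close>, \<open>a\<close> the bump that is its derivative. The same functions are used
  in all three coordinates: bumps in the plane of projection and steps in the height.
  The symmetry under sign change exchanges ``below'' and ``above''.
\<close>

locale step_kernel =
  fixes e :: real and S a a' :: "real \<Rightarrow> real"
  assumes e_pos: "0 < e"
    and S_deriv: "(S has_real_derivative a u) (at u)"
    and a_deriv: "(a has_real_derivative a' u) (at u)"
    and a'_continuous: "continuous_on UNIV a'"
    and a_zero: "e \<le> \<bar>u\<bar> \<Longrightarrow> a u = 0"
    and a_pos: "\<bar>u\<bar> < e \<Longrightarrow> 0 < a u"
    and S_low: "u \<le> - e \<Longrightarrow> S u = 0"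
    and S_high: "e \<le> u \<Longrightarrow> S u = 1"
    and S_minus: "S (- u) = 1 - S u"
    and a_minus: "a (- u) = a u"

text \<open>
  The primitive of the even bump \<open>(max 0 (e\<^sup>2 - u\<^sup>2))\<^sup>2\<close>, normalised to total mass 1.
\<close>

lemma step_kernel_exists:
  assumes "0 < e"
  obtains S a a' where "step_kernel e S a a'"
proof -
  define b where "b = (\<lambda>u::real. (max 0 (e\<^sup>2 - u\<^sup>2))\<^sup>2)"
  define N where "N = 2 * primitive b e"
  define a where "a = (\<lambda>u. b u / N)"
  define a' where "a' = (\<lambda>u. 2 * max 0 (e\<^sup>2 - u\<^sup>2) * (- (2 * u)) / N)"
  define S where "S = (\<lambda>u. 1 / 2 + primitive b u / N)"
  have b_cont: "continuous_on UNIV b" unfolding b_def by (intro continuous_intros)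
  note P = primitive_has_derivative[OF b_cont]
  have b_pos: "b u > 0" if "\<bar>u\<bar> < e" for u
    using that power_strict_mono[of "\<bar>u\<bar>" e 2] by (simp add: b_def)
  have b_zero: "b u = 0" if "e \<le> \<bar>u\<bar>" for u
    using that power_mono[of e "\<bar>u\<bar>" 2] assms by (simp add: b_def)
  have "continuous_on {0..e} (primitive b)"
    by (rule DERIV_continuous_on) (rule has_field_derivative_at_within[OF P])
  then have "primitive b 0 < primitive b e"
    using P b_pos by (intro DERIV_pos_imp_increasing_open[OF assms]) force+
  then have N: "N > 0" by (simp add: N_def)
  have b_minus: "b (- u) = b u" for u by (simp add: b_def)
  have odd: "primitive b (- u) = - primitive b u" for u
    by (simp add: primitive_def b_minus)
  have high: "primitive b u = primitive b e" if "e \<le> u" for u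
  proof (cases "u = e")
    case False
    with that have "e < u" by simp
    then obtain z where "e < z" "primitive b u - primitive b e = (u - e) * b z"
      using MVT2[of e u "primitive b" b] P by auto
    then show ?thesis using b_zero[of z] by simp
  qed simp
  have "step_kernel e S a a'"
  proof
    show "(S has_real_derivative a u) (at u)" for u
      unfolding S_def a_def using N by (auto intro!: derivative_eq_intros P)
    show "(a has_real_derivative a' u) (at u)" for u
      unfolding a_def a'_def b_def
      by (rule DERIV_cdivide, rule DERIV_chain2[OF max_zero_square_deriv]) (auto intro!: derivative_eq_intros)
    show "continuous_on UNIV a'"
      unfolding a'_def using N by (intro continuous_intros) auto
    show "S u = 1" if "e \<le> u" for u
      using N high[OF that] by (simp add: S_def N_def)
    show "S u = 0" if "u \<le> - e" for u
    proof -
      have "primitive b u = - primitive b e" using high[of "- u"] that odd[of u] by simp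
      then show ?thesis using N by (simp add: S_def N_def)
    qed
    show "S (- u) = 1 - S u" for u by (simp add: S_def odd)
  qed (use assms N b_pos b_zero b_minus in \<open>auto simp: a_def\<close>)
  with that show thesis .
qed

context step_kernel
begin

lemma S_continuous: "continuous_on UNIV S"
  using S_deriv by (meson DERIV_continuous_on has_field_derivative_at_within)

lemma a_continuous: "continuous_on UNIV a"
  using a_deriv by (meson DERIV_continuous_on has_field_derivative_at_within)

lemmas kernel_continuous [continuous_intros] =
  continuous_on_compose2[OF S_continuous _ subset_UNIV]
  continuous_on_compose2[OF a_continuous _ subset_UNIV]
  continuous_on_compose2[OF a'_continuous _ subset_UNIV]

text \<open>
  The difference of two points that are far apart on the scale of the bumps. The factor 2 leaves room
  for the sum of two differences that are smaller than \<open>e\<close>.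
\<close>

definition sep :: "real^3 \<Rightarrow> bool" where
  "sep p \<longleftrightarrow> (\<exists>i. 2 * e \<le> \<bar>p $ i\<bar>)"

lemma sep_minus [simp]: "sep (- p) = sep p"
  by (simp add: sep_def)

lemma sep_3: "sep p \<longleftrightarrow> 2 * e \<le> \<bar>p $ 1\<bar> \<or> 2 * e \<le> \<bar>p $ 2\<bar> \<or> 2 * e \<le> \<bar>p $ 3\<bar>"
  unfolding sep_def using forall_3[of "\<lambda>i. \<not> 2 * e \<le> \<bar>p $ i\<bar>"] by blast

lemma a_nonzero: "a u \<noteq> 0 \<Longrightarrow> \<bar>u\<bar> < e"
  using a_zero by force

text \<open>
  The coefficient of the smeared crossing form; \<open>h\<close> is \<open>S\<close> to select the crossings at which the first
  curve is below the second, and \<open>1 - S\<close> for those at which it is above. The functions \<open>bump_1\<close>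
  and \<open>bump_2\<close> are its planar derivatives.
\<close>

definition bump :: "(real \<Rightarrow> real) \<Rightarrow> real^3 \<Rightarrow> real" where
  "bump h p = h (p $ 3) * (a (p $ 1) * a (p $ 2))"

definition bump_1 :: "(real \<Rightarrow> real) \<Rightarrow> real^3 \<Rightarrow> real" where
  "bump_1 h p = h (p $ 3) * (a' (p $ 1) * a (p $ 2))"

definition bump_2 :: "(real \<Rightarrow> real) \<Rightarrow> real^3 \<Rightarrow> real" where
  "bump_2 h p = h (p $ 3) * (a (p $ 1) * a' (p $ 2))"

lemma linear_comp_has_derivative:
  fixes l :: "'a::real_normed_vector \<Rightarrow> real"
  assumes "bounded_linear l" "(f has_real_derivative f') (at (l p))"
  shows "((\<lambda>p. f (l p)) has_derivative (\<lambda>k. f' * l k)) (at p)"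
  using has_derivative_compose[OF bounded_linear_imp_has_derivative[OF assms(1)]
      assms(2)[unfolded has_field_derivative_def]] .

text \<open>
  For separated points the derivative with respect to the height carries the factor
  \<open>a(p\<^sub>1) a(p\<^sub>2) a(p\<^sub>3) = 0\<close>.
\<close>

lemma bump_has_derivative:
  assumes "sep p" and h: "\<And>u. (h has_real_derivative s * a u) (at u)"
  shows "(bump h has_derivative (\<lambda>k. bump_1 h p * k $ 1 + bump_2 h p * k $ 2)) (at p)"
proof -
  have z: "a (p $ 3) = 0 \<or> a (p $ 1) = 0 \<or> a (p $ 2) = 0"
    using \<open>sep p\<close> a_nonzero[of "p $ 1"] a_nonzero[of "p $ 2"] a_nonzero[of "p $ 3"] e_pos
    unfolding sep_3 by linarith
  note d = linear_comp_has_derivative[where p=p, OF bounded_linear_vec_nth]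
  have "((\<lambda>p. h (p $ 3) * (a (p $ 1) * a (p $ 2))) has_derivative
      (\<lambda>k. h (p $ 3) * (a (p $ 1) * (a' (p $ 2) * k $ 2) + (a' (p $ 1) * k $ 1) * a (p $ 2))
        + (s * a (p $ 3) * k $ 3) * (a (p $ 1) * a (p $ 2)))) (at p)"
    by (intro has_derivative_mult d h a_deriv)
  then show ?thesis
    unfolding bump_def[abs_def] bump_1_def bump_2_def
    by (rule has_derivative_eq_rhs) (use z in \<open>auto simp: fun_eq_iff algebra_simps\<close>)
qed

text \<open>
  The correction forms are \<open>correction dp\<^sub>1 \<and> dp\<^sub>2 \<and> dq\<^sub>i\<close> with \<open>p + q\<close> the difference of the outer points. The
  factor \<open>S(q\<^sub>j) - S(p\<^sub>j + q\<^sub>j)\<close> is a primitive of \<open>a(q\<^sub>j) - a(p\<^sub>j + q\<^sub>j)\<close> that vanishes for large \<open>q\<^sub>j\<close> when \<open>p\<^sub>j\<close> is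
  small, so it trades the bump for the pair \<open>q\<close> against the bump for the pair \<open>p + q\<close> in the \<open>j\<close>-th coordinate.
  The last factor is the bump in the other coordinate, for \<open>q\<close> if \<open>c = 0\<close> (not yet traded) and
  for \<open>p + q\<close> if \<open>c = 1\<close> (already traded); trading both coordinates in turn takes two forms.
\<close>

definition correction :: "(real \<Rightarrow> real) \<Rightarrow> real \<Rightarrow> 3 \<Rightarrow> 3 \<Rightarrow> real^3 \<Rightarrow> real^3 \<Rightarrow> real" where
  "correction h c i j p q = S (p $ 3) * h (p $ 3 + q $ 3) * (a (p $ 1) * a (p $ 2))
     * (S (q $ j) - S (p $ j + q $ j)) * a (q $ i + c * p $ i)"

text \<open>
  The partial derivative of \<open>correction\<close> with respect to \<open>p\<^sub>n\<close>, where \<open>n\<close> is 1 or 2 and \<open>{i, j} = {1, 2}\<close>;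
  \<open>correction_j\<close> and \<open>correction_i\<close> are those with respect to \<open>q\<^sub>j\<close> and \<open>q\<^sub>i\<close>.
\<close>

definition correction_p :: "3 \<Rightarrow> (real \<Rightarrow> real) \<Rightarrow> real \<Rightarrow> 3 \<Rightarrow> 3 \<Rightarrow> real^3 \<Rightarrow> real^3 \<Rightarrow> real" where
  "correction_p n h c i j p q = S (p $ 3) * h (p $ 3 + q $ 3) *
     ((if n = 1 then a' (p $ 1) * a (p $ 2) else a (p $ 1) * a' (p $ 2))
       * (S (q $ j) - S (p $ j + q $ j)) * a (q $ i + c * p $ i)
      + a (p $ 1) * a (p $ 2) * (if n = j then - a (p $ j + q $ j) * a (q $ i + c * p $ i)
          else (S (q $ j) - S (p $ j + q $ j)) * (c * a' (q $ i + c * p $ i))))"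

definition correction_j :: "(real \<Rightarrow> real) \<Rightarrow> real \<Rightarrow> 3 \<Rightarrow> 3 \<Rightarrow> real^3 \<Rightarrow> real^3 \<Rightarrow> real" where
  "correction_j h c i j p q = S (p $ 3) * h (p $ 3 + q $ 3) * (a (p $ 1) * a (p $ 2))
     * (a (q $ j) - a (p $ j + q $ j)) * a (q $ i + c * p $ i)"

definition correction_i :: "(real \<Rightarrow> real) \<Rightarrow> real \<Rightarrow> 3 \<Rightarrow> 3 \<Rightarrow> real^3 \<Rightarrow> real^3 \<Rightarrow> real" where
  "correction_i h c i j p q = S (p $ 3) * h (p $ 3 + q $ 3) * (a (p $ 1) * a (p $ 2))
     * (S (q $ j) - S (p $ j + q $ j)) * a' (q $ i + c * p $ i)"

text \<open>
  The derivatives of the two step functions of the heights drop out. For \<open>p\<close> this is the argument for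
  \<open>bump\<close>. For \<open>p + q\<close>, a nonzero value of the planar factors bounds both planar coordinates
  of \<open>p + q\<close> by \<open>2 * e\<close>, so that separation keeps its height away from the transition.
\<close>

lemma correction_has_derivative:
  fixes p q :: "real^3"
  assumes sep: "sep p" "sep (p + q)" and h: "\<And>u. (h has_real_derivative s * a u) (at u)"
    and c: "c = 0 \<or> c = 1" and ij: "i = 1 \<and> j = 2 \<or> i = 2 \<and> j = 1"
  shows "((\<lambda>r. correction h c i j (fst r) (snd r)) has_derivative
     (\<lambda>k. correction_p 1 h c i j p q * fst k $ 1 + correction_p 2 h c i j p q * fst k $ 2
       + correction_j h c i j p q * snd k $ j + correction_i h c i j p q * snd k $ i)) (at (p, q))"
proof -
  have z1: "a (p $ 3) = 0 \<or> a (p $ 1) = 0 \<or> a (p $ 2) = 0"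
    using \<open>sep p\<close> a_nonzero[of "p $ 1"] a_nonzero[of "p $ 2"] a_nonzero[of "p $ 3"] e_pos
    unfolding sep_3 by linarith
  have "\<bar>p $ j + q $ j\<bar> < 2 * e" if "\<bar>p $ j\<bar> < e" "S (q $ j) \<noteq> S (p $ j + q $ j)"
    using that S_high[of "q $ j"] S_high[of "p $ j + q $ j"] S_low[of "q $ j"] S_low[of "p $ j + q $ j"]
    by (smt (verit))
  then have z2: "a (p $ 3 + q $ 3) = 0 \<or> a (p $ 1) = 0 \<or> a (p $ 2) = 0
      \<or> S (q $ j) = S (p $ j + q $ j) \<or> a (q $ i + c * p $ i) = 0"
    using sep(2) c ij a_nonzero[of "p $ 1"] a_nonzero[of "p $ 2"] a_nonzero[of "p $ 3 + q $ 3"]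
      a_nonzero[of "q $ i + c * p $ i"] e_pos
    unfolding sep_3 by (auto; smt (verit))
  define L where "L = (\<lambda>r::(real^3) \<times> (real^3). \<lambda>n::3. fst r $ n)"
  define R where "R = (\<lambda>r::(real^3) \<times> (real^3). \<lambda>n::3. snd r $ n)"
  have lin: "bounded_linear (\<lambda>r. L r n)" "bounded_linear (\<lambda>r. R r n)" for n
    unfolding L_def R_def
    by (intro bounded_linear_compose[OF bounded_linear_vec_nth] bounded_linear_fst bounded_linear_snd)+
  have lin2: "bounded_linear (\<lambda>r. L r n + R r n)" "bounded_linear (\<lambda>r. R r n + c * L r n)" for n
    by (intro bounded_linear_add lin bounded_linear_const_mult)+
  note d = lin[THEN linear_comp_has_derivative] lin2[THEN linear_comp_has_derivative]
  have "((\<lambda>r. S (L r 3) * h (L r 3 + R r 3) * (a (L r 1) * a (L r 2))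
     * (S (R r j) - S (L r j + R r j)) * a (R r i + c * L r i)) has_derivative
     (\<lambda>k. S (L (p, q) 3) * h (L (p, q) 3 + R (p, q) 3) * (a (L (p, q) 1) * a (L (p, q) 2))
         * (S (R (p, q) j) - S (L (p, q) j + R (p, q) j)) * (a' (R (p, q) i + c * L (p, q) i) * (R k i + c * L k i))
       + (S (L (p, q) 3) * h (L (p, q) 3 + R (p, q) 3) * (a (L (p, q) 1) * a (L (p, q) 2))
           * (a (R (p, q) j) * R k j - a (L (p, q) j + R (p, q) j) * (L k j + R k j))
         + (S (L (p, q) 3) * h (L (p, q) 3 + R (p, q) 3)
             * (a (L (p, q) 1) * (a' (L (p, q) 2) * L k 2) + a' (L (p, q) 1) * L k 1 * a (L (p, q) 2))
           + (S (L (p, q) 3) * (s * a (L (p, q) 3 + R (p, q) 3) * (L k 3 + R k 3))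
             + a (L (p, q) 3) * L k 3 * h (L (p, q) 3 + R (p, q) 3))
             * (a (L (p, q) 1) * a (L (p, q) 2)))
           * (S (R (p, q) j) - S (L (p, q) j + R (p, q) j))) * a (R (p, q) i + c * L (p, q) i))) (at (p, q))"
    by (intro has_derivative_mult has_derivative_diff d h a_deriv S_deriv)
  then show ?thesis
    unfolding correction_def[abs_def] correction_p_def correction_i_def correction_j_def L_def R_def fst_conv snd_conv
    by (rule has_derivative_eq_rhs) (use ij z1 z2 in \<open>auto simp: fun_eq_iff algebra_simps\<close>)
qed

lemma bump_continuous:
  assumes [continuous_intros]: "continuous_on UNIV h"
  shows "continuous_on UNIV (bump h)" "continuous_on UNIV (bump_1 h)" "continuous_on UNIV (bump_2 h)"
proof -
  note [continuous_intros] = continuous_on_compose2[OF assms _ subset_UNIV]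
  show "continuous_on UNIV (bump h)" "continuous_on UNIV (bump_1 h)" "continuous_on UNIV (bump_2 h)"
    unfolding bump_def[abs_def] bump_1_def[abs_def] bump_2_def[abs_def] by (intro continuous_intros)+
qed

lemma correction_continuous:
  assumes "continuous_on UNIV h"
  shows "continuous_on UNIV (\<lambda>(p, q). correction h c i j p q)" "continuous_on UNIV (\<lambda>(p, q). correction_p n h c i j p q)"
    "continuous_on UNIV (\<lambda>(p, q). correction_i h c i j p q)" "continuous_on UNIV (\<lambda>(p, q). correction_j h c i j p q)"
proof -
  note [continuous_intros] = continuous_on_compose2[OF assms _ subset_UNIV]
  show "continuous_on UNIV (\<lambda>(p, q). correction h c i j p q)" 
    "continuous_on UNIV (\<lambda>(p, q). correction_i h c i j p q)" "continuous_on UNIV (\<lambda>(p, q). correction_j h c i j p q)"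
    unfolding correction_def correction_i_def correction_j_def split_beta by (intro continuous_intros)+
  show "continuous_on UNIV (\<lambda>(p, q). correction_p n h c i j p q)"
    by (cases "n = 1"; cases "n = j"; simp add: correction_p_def split_beta; intro continuous_intros)
qed

abbreviation coS :: "real \<Rightarrow> real" where "coS u \<equiv> 1 - S u"

text \<open>
  Near a triple point the three heights are far apart, the steps take the values 0 and 1, and the first
  factor vanishes for each of the six orders of three points: it is the relation
  \<open>[1<2][2<3] - [1<2][1<3] + [1<3][3<2] = 0\<close>.
\<close>

lemma arnold_height:
  assumes "sep p" "sep q" "sep (p + q)"
  shows "(S (p $ 3) * S (q $ 3) - S (p $ 3) * S (p $ 3 + q $ 3) + S (p $ 3 + q $ 3) * (1 - S (q $ 3)))
    * (a (p $ 1) * a (p $ 2) * (a (q $ 1) * a (q $ 2))) = 0"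
proof (rule ccontr)
  assume "\<not> ?thesis"
  then have "a (p $ 1) \<noteq> 0" "a (p $ 2) \<noteq> 0" "a (q $ 1) \<noteq> 0" "a (q $ 2) \<noteq> 0"
    and ne: "S (p $ 3) * S (q $ 3) - S (p $ 3) * S (p $ 3 + q $ 3) + S (p $ 3 + q $ 3) * (1 - S (q $ 3)) \<noteq> 0"
    by auto
  then have "\<bar>p $ 1\<bar> < e" "\<bar>p $ 2\<bar> < e" "\<bar>q $ 1\<bar> < e" "\<bar>q $ 2\<bar> < e"
    by (auto dest: a_nonzero)
  then have big: "e \<le> \<bar>p $ 3\<bar>" "e \<le> \<bar>q $ 3\<bar>" "e \<le> \<bar>p $ 3 + q $ 3\<bar>"
    using assms e_pos unfolding sep_3 by auto
  have S01: "S u = (if 0 < u then 1 else 0)" if "e \<le> \<bar>u\<bar>" for u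
    using that S_high[of u] S_low[of u] e_pos by (auto split: if_splits)
  show False
    using ne unfolding S01[OF big(1)] S01[OF big(2)] S01[OF big(3)] by (auto split: if_splits)
qed

text \<open>
  Expressed by derivatives of the curves themselves, so that the invariants below depend on the two
  curves only and not on a motion to which they belong.
\<close>

definition density :: "(real \<Rightarrow> real) \<Rightarrow> (real \<Rightarrow> real^3) \<Rightarrow> (real \<Rightarrow> real^3) \<Rightarrow> real \<Rightarrow> real \<Rightarrow> real" where
  "density h c d x y = bump h (d y - c x) *
     planar_cross (- vector_derivative c (at x)) (vector_derivative d (at y))"

definition triple_density where
  "triple_density h k i j A B C x y z = correction h k i j (B y - A x) (C z - B y) *
     (planar_cross (- vector_derivative A (at x)) (vector_derivative B (at y)) * vector_derivative C (at z) $ i)"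

definition linking where
  "linking h c d = circle_integral (\<lambda>x. circle_integral (\<lambda>y. density h c d x y))"

text \<open>
  The three products belong to the chains \<open>A < B < C\<close>, \<open>A < B\<close> with \<open>A < C\<close>, and \<open>A < C\<close> with \<open>C < B\<close>, in terms of
  heights; each is taken over the shared component. The first two corrections replace the bump for
  \<open>BC\<close> by that for \<open>AC\<close> next to the bump for \<open>AB\<close>. The last two replace \<open>AB\<close> by \<open>AC\<close> next to \<open>BC\<close>; they are
  obtained by reading the three curves backwards, which turns \<open>S\<close> into \<open>1 - S\<close>.
\<close>

definition triple_linking :: "(real \<Rightarrow> real^3) \<Rightarrow> (real \<Rightarrow> real^3) \<Rightarrow> (real \<Rightarrow> real^3) \<Rightarrow> real" where
  "triple_linking A B C =
     cup (\<lambda>y. circle_integral (\<lambda>x. density S A B x y)) (\<lambda>y. circle_integral (\<lambda>z. density S B C y z))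
   - cup (\<lambda>x. circle_integral (\<lambda>y. density S A B x y)) (\<lambda>x. circle_integral (\<lambda>z. density S A C x z))
   + cup (\<lambda>z. circle_integral (\<lambda>x. density S A C x z)) (\<lambda>z. circle_integral (\<lambda>y. density coS B C y z))
   + torus_integral (triple_density S 0 2 1 A B C) - torus_integral (triple_density S 1 1 2 A B C)
   + torus_integral (triple_density coS 1 2 1 C B A) - torus_integral (triple_density coS 0 1 2 C B A)"

end

section \<open>Invariance under smooth motion\<close>

locale moving_link = step_kernel e S a a' +
  A: moving_curve A At Ax Atx + B: moving_curve B Bt Bx Btx + C: moving_curve C Ct Cx Ctx
  for e S a a' A At Ax Atx B Bt Bx Btx C Ct Cx Ctx +
  assumes separated: "sep (B t y - A t x)" "sep (C t z - B t y)" "sep (C t z - A t x)"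
begin

lemma coS_deriv: "(coS has_real_derivative (-1) * a u) (at u)"
  by (auto intro!: derivative_eq_intros S_deriv)

lemma S_deriv': "(S has_real_derivative 1 * a u) (at u)"
  using S_deriv by simp

lemma coS_continuous: "continuous_on UNIV coS"
  by (intro continuous_intros)

sublocale AB: moving_pair A At Ax Atx B Bt Bx Btx "bump S" "bump_1 S" "bump_2 S"
  by unfold_locales
    (intro bump_has_derivative[OF _ S_deriv'] separated bump_continuous S_continuous)+

sublocale BC: moving_pair B Bt Bx Btx C Ct Cx Ctx "bump S" "bump_1 S" "bump_2 S"
  by unfold_locales
    (intro bump_has_derivative[OF _ S_deriv'] separated bump_continuous S_continuous)+

sublocale AC: moving_pair A At Ax Atx C Ct Cx Ctx "bump S" "bump_1 S" "bump_2 S"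
  by unfold_locales
    (intro bump_has_derivative[OF _ S_deriv'] separated bump_continuous S_continuous)+

sublocale BC': moving_pair B Bt Bx Btx C Ct Cx Ctx "bump coS" "bump_1 coS" "bump_2 coS"
  by unfold_locales
    (intro bump_has_derivative[OF _ coS_deriv] separated bump_continuous coS_continuous)+

lemma separated_sum: "sep ((B t y - A t x) + (C t z - B t y))"
  "sep ((B t y - C t z) + (A t x - B t y))"
  using separated(3)[of t z x] sep_minus[of "C t z - A t x"] by simp_all

lemma separated_minus: "sep (B t y - C t z)"
  using separated(2)[of t z y] sep_minus[of "C t z - B t y"] by simp

sublocale T1: moving_triple A At Ax Atx B Bt Bx Btx C Ct Cx Ctx
  "correction S 0 2 1" "correction_p 1 S 0 2 1" "correction_p 2 S 0 2 1" "correction_j S 0 2 1" "correction_i S 0 2 1" 2 1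
  by unfold_locales
    (simp_all only: correction_has_derivative[OF _ _ S_deriv'] separated separated_sum
      correction_continuous[OF S_continuous] simp_thms)

sublocale T2: moving_triple A At Ax Atx B Bt Bx Btx C Ct Cx Ctx
  "correction S 1 1 2" "correction_p 1 S 1 1 2" "correction_p 2 S 1 1 2" "correction_j S 1 1 2" "correction_i S 1 1 2" 1 2
  by unfold_locales
    (simp_all only: correction_has_derivative[OF _ _ S_deriv'] separated separated_sum
      correction_continuous[OF S_continuous] simp_thms)

sublocale T3: moving_triple C Ct Cx Ctx B Bt Bx Btx A At Ax Atx
  "correction coS 1 2 1" "correction_p 1 coS 1 2 1" "correction_p 2 coS 1 2 1" "correction_j coS 1 2 1" "correction_i coS 1 2 1" 2 1
  by unfold_locales
    (simp_all only: correction_has_derivative[OF _ _ coS_deriv] separated_minus separated_sum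
      correction_continuous[OF coS_continuous] simp_thms)

sublocale T4: moving_triple C Ct Cx Ctx B Bt Bx Btx A At Ax Atx
  "correction coS 0 1 2" "correction_p 1 coS 0 1 2" "correction_p 2 coS 0 1 2" "correction_j coS 0 1 2" "correction_i coS 0 1 2" 1 2
  by unfold_locales
    (simp_all only: correction_has_derivative[OF _ _ coS_deriv] separated_minus separated_sum
      correction_continuous[OF coS_continuous] simp_thms)

lemma density_eq:
  "density S (A t) (B t) = AB.dens t" "density S (B t) (C t) = BC.dens t"
  "density S (A t) (C t) = AC.dens t" "density coS (B t) (C t) = BC'.dens t"
  by (intro ext; simp add: density_def AB.dens_def BC.dens_def AC.dens_def BC'.dens_def
      A.tangent B.tangent C.tangent)+

lemma triple_density_eq:
  "triple_density S 0 2 1 (A t) (B t) (C t) = T1.vol t" "triple_density S 1 1 2 (A t) (B t) (C t) = T2.vol t"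
  "triple_density coS 1 2 1 (C t) (B t) (A t) = T3.vol t" "triple_density coS 0 1 2 (C t) (B t) (A t) = T4.vol t"
  by (intro ext; simp add: triple_density_def T1.vol_def T2.vol_def T3.vol_def T4.vol_def
      A.tangent B.tangent C.tangent)+

lemma linking_eq:
  "linking S (A t) (B t) = AB.total t" "linking S (B t) (C t) = BC.total t"
  "linking S (A t) (C t) = AC.total t" "linking coS (B t) (C t) = BC'.total t"
  by (simp_all add: linking_def density_eq AB.total_def BC.total_def AC.total_def BC'.total_def
      AB.first_dens_def[abs_def] BC.first_dens_def[abs_def] AC.first_dens_def[abs_def] BC'.first_dens_def[abs_def])

lemma linking_constant:
  "linking S (A s) (B s) = linking S (A t) (B t)" "linking S (B s) (C s) = linking S (B t) (C t)"
  "linking S (A s) (C s) = linking S (A t) (C t)" "linking coS (B s) (C s) = linking coS (B t) (C t)"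
  unfolding linking_eq
  by (rule AB.total_constant BC.total_constant AC.total_constant BC'.total_constant)+

lemma triple_linking_eq:
  "triple_linking (A t) (B t) (C t) =
     cup (AB.second_dens t) (BC.first_dens t) - cup (AB.first_dens t) (AC.first_dens t)
   + cup (AC.second_dens t) (BC'.second_dens t)
   + torus_integral (T1.vol t) - torus_integral (T2.vol t) + torus_integral (T3.vol t) - torus_integral (T4.vol t)"
  by (simp add: triple_linking_def density_eq triple_density_eq AB.second_dens_def[abs_def]
     AB.first_dens_def[abs_def] BC.first_dens_def[abs_def] AC.first_dens_def[abs_def]
     AC.second_dens_def[abs_def] BC'.second_dens_def[abs_def])

text \<open>
  Up to sign, the coefficients of \<open>dt \<and> dx \<and> dy \<and> dz\<close> in the wedge products of two crossing forms, as they
  arise from \<open>cup_has_derivative\<close>.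
\<close>

definition wedge_AB_BC where
  "wedge_AB_BC t x y z = - AB.flux_y t x y * BC.dens t y z - AB.dens t x y * BC.flux_x t y z"
definition wedge_AB_AC where
  "wedge_AB_AC t x y z = AB.flux_x t x y * AC.dens t x z - AB.dens t x y * AC.flux_x t x z"
definition wedge_AC_BC where
  "wedge_AC_BC t x y z = - AC.flux_y t x z * BC'.dens t y z + AC.dens t x z * BC'.flux_y t y z"

lemmas pair_continuous2 [continuous_intros] = 
  AB.continuous_pair[THEN continuous_on_slice3] BC.continuous_pair[THEN continuous_on_slice3]
  AC.continuous_pair[THEN continuous_on_slice3] BC'.continuous_pair[THEN continuous_on_slice3]

lemmas marginal_continuous [continuous_intros] =
  AB.continuous_marginal[THEN continuous_on_slice2] BC.continuous_marginal[THEN continuous_on_slice2]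
  AC.continuous_marginal[THEN continuous_on_slice2] BC'.continuous_marginal[THEN continuous_on_slice2]

lemma cup_AB_BC:
  assumes "\<And>t. AB.total t = 0" "\<And>t. BC.total t = 0"
  shows "((\<lambda>t. cup (AB.second_dens t) (BC.first_dens t)) has_real_derivative torus_integral (wedge_AB_BC t)) (at t)"
proof -
  have "((\<lambda>t. cup (AB.second_dens t) (BC.first_dens t)) has_real_derivative
     circle_integral (\<lambda>y. AB.second_flux t y * BC.first_dens t y - AB.second_dens t y * BC.first_flux t y)) (at t)"
    by (rule cup_has_derivative[OF AB.second_dens_has_derivative AB.second_flux_has_derivative
          BC.first_dens_has_derivative BC.first_flux_has_derivative])
      (simp_all add: AB.continuous_marginal BC.continuous_marginal AB.total_eq BC.total_def[symmetric] assms)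
  also have "circle_integral (\<lambda>y. AB.second_flux t y * BC.first_dens t y - AB.second_dens t y * BC.first_flux t y)
    = circle_integral (\<lambda>y. AB.second_flux t y * BC.first_dens t y) - circle_integral (\<lambda>y. AB.second_dens t y * BC.first_flux t y)"
    by (intro circ_diff continuous_intros)
  also have "\<dots> = torus_integral (\<lambda>x y z. - AB.flux_y t x y * BC.dens t y z) - torus_integral (\<lambda>x y z. AB.dens t x y * BC.flux_x t y z)"
    unfolding AB.second_flux_def BC.first_dens_def AB.second_dens_def BC.first_flux_def
    by (intro arg_cong2[where f="(-)"] torus_common_2; unfold split_beta; intro continuous_intros)
  also have "\<dots> = torus_integral (wedge_AB_BC t)"
    unfolding wedge_AB_BC_def by (rule torus_diff[symmetric]; unfold split_beta; intro continuous_intros)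
  finally show ?thesis .
qed

lemma cup_AB_AC:
  assumes "\<And>t. AB.total t = 0" "\<And>t. AC.total t = 0"
  shows "((\<lambda>t. cup (AB.first_dens t) (AC.first_dens t)) has_real_derivative torus_integral (wedge_AB_AC t)) (at t)"
proof -
  have "((\<lambda>t. cup (AB.first_dens t) (AC.first_dens t)) has_real_derivative
     circle_integral (\<lambda>x. AB.first_flux t x * AC.first_dens t x - AB.first_dens t x * AC.first_flux t x)) (at t)"
    by (rule cup_has_derivative[OF AB.first_dens_has_derivative AB.first_flux_has_derivative
          AC.first_dens_has_derivative AC.first_flux_has_derivative])
      (simp_all add: AB.continuous_marginal AC.continuous_marginal AB.total_def[symmetric] AC.total_def[symmetric] assms)
  also have "circle_integral (\<lambda>x. AB.first_flux t x * AC.first_dens t x - AB.first_dens t x * AC.first_flux t x)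
    = circle_integral (\<lambda>x. AB.first_flux t x * AC.first_dens t x) - circle_integral (\<lambda>x. AB.first_dens t x * AC.first_flux t x)"
    by (intro circ_diff continuous_intros)
  also have "\<dots> = torus_integral (\<lambda>x y z. AB.flux_x t x y * AC.dens t x z) - torus_integral (\<lambda>x y z. AB.dens t x y * AC.flux_x t x z)"
    unfolding AB.first_flux_def AC.first_dens_def AB.first_dens_def AC.first_flux_def
    by (intro arg_cong2[where f="(-)"] torus_common_1)
  also have "\<dots> = torus_integral (wedge_AB_AC t)"
    unfolding wedge_AB_AC_def by (rule torus_diff[symmetric]; unfold split_beta; intro continuous_intros)
  finally show ?thesis .
qed

lemma cup_AC_BC:
  assumes "\<And>t. AC.total t = 0" "\<And>t. BC'.total t = 0"
  shows "((\<lambda>t. cup (AC.second_dens t) (BC'.second_dens t)) has_real_derivative torus_integral (wedge_AC_BC t)) (at t)"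
proof -
  have "((\<lambda>t. cup (AC.second_dens t) (BC'.second_dens t)) has_real_derivative
     circle_integral (\<lambda>z. AC.second_flux t z * BC'.second_dens t z - AC.second_dens t z * BC'.second_flux t z)) (at t)"
    by (rule cup_has_derivative[OF AC.second_dens_has_derivative AC.second_flux_has_derivative
          BC'.second_dens_has_derivative BC'.second_flux_has_derivative])
      (simp_all add: AC.continuous_marginal BC'.continuous_marginal AC.total_eq BC'.total_eq assms)
  also have "circle_integral (\<lambda>z. AC.second_flux t z * BC'.second_dens t z - AC.second_dens t z * BC'.second_flux t z)
    = circle_integral (\<lambda>z. AC.second_flux t z * BC'.second_dens t z) - circle_integral (\<lambda>z. AC.second_dens t z * BC'.second_flux t z)"
    by (intro circ_diff continuous_intros)
  also have "\<dots> = torus_integral (\<lambda>x y z. - AC.flux_y t x z * BC'.dens t y z) - torus_integral (\<lambda>x y z. AC.dens t x z * - BC'.flux_y t y z)"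
    unfolding AC.second_flux_def BC'.second_dens_def AC.second_dens_def BC'.second_flux_def
    by (intro arg_cong2[where f="(-)"] torus_common_3; unfold split_beta; intro continuous_intros)
  also have "\<dots> = torus_integral (\<lambda>x y z. - AC.flux_y t x z * BC'.dens t y z - AC.dens t x z * - BC'.flux_y t y z)"
    by (rule torus_diff[symmetric]; unfold split_beta; intro continuous_intros)
  also have "\<dots> = torus_integral (wedge_AC_BC t)"
    unfolding wedge_AC_BC_def by (rule torus_cong) simp
  finally show ?thesis .
qed

text \<open>
  All seven terms are multiples of one Jacobian determinant \<open>D\<close> of the four planar coordinates of
  \<open>B - A\<close> and \<open>C - B\<close>. The corrections are made to replace every bump factor by
  \<open>a(p\<^sub>1) a(p\<^sub>2) a(q\<^sub>1) a(q\<^sub>2)\<close>, and then the coefficient is that of the relation between the heights.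
\<close>

lemma arnold_relation:
  "wedge_AB_BC t x y z - wedge_AB_AC t x y z + wedge_AC_BC t x y z
   + correction_j S 0 2 1 (B t y - A t x) (C t z - B t y) * T1.jac t x y z
   - correction_j S 1 1 2 (B t y - A t x) (C t z - B t y) * T2.jac t x y z
   + correction_j coS 1 2 1 (B t y - C t z) (A t x - B t y) * T3.jac t z y x
   - correction_j coS 0 1 2 (B t y - C t z) (A t x - B t y) * T4.jac t z y x = 0"
proof -
  define p where "p = B t y - A t x"
  define q where "q = C t z - B t y"
  define pt where "pt = Bt t y - At t x"
  define qt where "qt = Ct t z - Bt t y"
  define D where "D = T1.jac t x y z"
  have r: "C t z - A t x = p + q" and rt: "Ct t z - At t x = pt + qt"
    and p': "A t x - B t y = - p" and q': "B t y - C t z = - q"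
    and pt': "At t x - Bt t y = - pt" and qt': "Bt t y - Ct t z = - qt"
    by (simp_all add: p_def q_def pt_def qt_def)
  note fold = p_def[symmetric] q_def[symmetric] pt_def[symmetric] qt_def[symmetric] r rt p' q' pt' qt'
  have J: "T2.jac t x y z = - D" "T3.jac t z y x = - D" "T4.jac t z y x = D"
    unfolding D_def T1.jac_def T2.jac_def T3.jac_def T4.jac_def fold minor_def planar_cross_def
    by (simp_all add: algebra_simps)
  have "wedge_AB_BC t x y z = - (bump S p * bump S q) *
     (planar_cross (pt) (- Ax t x) * planar_cross (- Bx t y) (Cx t z) + planar_cross (- Ax t x) (Bx t y) * planar_cross qt (Cx t z))"
    unfolding wedge_AB_BC_def AB.flux_y_def BC.dens_def AB.dens_def BC.flux_x_def fold by (simp add: algebra_simps)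
  also have "planar_cross (pt) (- Ax t x) * planar_cross (- Bx t y) (Cx t z) + planar_cross (- Ax t x) (Bx t y) * planar_cross qt (Cx t z) = D"
    unfolding D_def T1.jac_def fold minor_def planar_cross_def by (simp add: algebra_simps)
  finally have 1: "wedge_AB_BC t x y z = - (bump S p * bump S q) * D" .
  have "wedge_AB_AC t x y z = - (bump S p * bump S (p + q)) *
     (planar_cross (- Ax t x) (Bx t y) * planar_cross (pt + qt) (Cx t z) - planar_cross pt (Bx t y) * planar_cross (- Ax t x) (Cx t z))"
    unfolding wedge_AB_AC_def AB.flux_x_def AC.dens_def AB.dens_def AC.flux_x_def fold by (simp add: algebra_simps)
  also have "planar_cross (- Ax t x) (Bx t y) * planar_cross (pt + qt) (Cx t z) - planar_cross pt (Bx t y) * planar_cross (- Ax t x) (Cx t z) = D"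
    unfolding D_def T1.jac_def fold minor_def planar_cross_def by (simp add: algebra_simps)
  finally have 2: "wedge_AB_AC t x y z = - (bump S p * bump S (p + q)) * D" .
  have "wedge_AC_BC t x y z = - (bump S (p + q) * bump coS q) *
     (planar_cross (pt + qt) (- Ax t x) * planar_cross (- Bx t y) (Cx t z) - planar_cross (- Ax t x) (Cx t z) * planar_cross qt (- Bx t y))"
    unfolding wedge_AC_BC_def AC.flux_y_def BC'.dens_def AC.dens_def BC'.flux_y_def fold by (simp add: algebra_simps)
  also have "planar_cross (pt + qt) (- Ax t x) * planar_cross (- Bx t y) (Cx t z) - planar_cross (- Ax t x) (Cx t z) * planar_cross qt (- Bx t y) = D"
    unfolding D_def T1.jac_def fold minor_def planar_cross_def by (simp add: algebra_simps)
  finally have 3: "wedge_AC_BC t x y z = - (bump S (p + q) * bump coS q) * D" .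
  have flip: "- p $ n - q $ n = - (p $ n + q $ n)" "- q $ n - p $ n = - (p $ n + q $ n)" for n
    by simp_all
  have m: "S (- p $ 3 - q $ 3) = 1 - S (p $ 3 + q $ 3)" "a (- p $ 1 - q $ 1) = a (p $ 1 + q $ 1)"
    "a (- p $ 2 - q $ 2) = a (p $ 2 + q $ 2)"
    unfolding flip S_minus a_minus by (rule refl)+
  have m': "S (- q $ 3 - p $ 3) = 1 - S (p $ 3 + q $ 3)" "a (- q $ 1 - p $ 1) = a (p $ 1 + q $ 1)"
    "a (- q $ 2 - p $ 2) = a (p $ 2 + q $ 2)"
    unfolding flip S_minus a_minus by (rule refl)+
  have "wedge_AB_BC t x y z - wedge_AB_AC t x y z + wedge_AC_BC t x y z + correction_j S 0 2 1 p q * D - correction_j S 1 1 2 p q * (- D)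
   + correction_j coS 1 2 1 (- q) (- p) * (- D) - correction_j coS 0 1 2 (- q) (- p) * D
   = - ((S (p $ 3) * S (q $ 3) - S (p $ 3) * S (p $ 3 + q $ 3) + S (p $ 3 + q $ 3) * (1 - S (q $ 3)))
    * (a (p $ 1) * a (p $ 2) * (a (q $ 1) * a (q $ 2)))) * D"
    unfolding 1 2 3 correction_j_def bump_def
    by (simp add: m m' S_minus a_minus) (simp add: algebra_simps)
  also have "\<dots> = 0"
    using arnold_height[of p q] separated(1)[of t y x] separated(2)[of t z y] separated_sum(1)[of t y x z]
    by (simp add: p_def q_def)
  finally show ?thesis
    unfolding D_def[symmetric] J fold .
qed

text \<open>
  The time derivative is the integral over the three-torus of the expression in \<open>arnold_relation\<close>.
\<close>

lemma triple_linking_constant: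
  assumes zero: "linking S (A 0) (B 0) = 0" "linking S (B 0) (C 0) = 0" "linking S (A 0) (C 0) = 0"
    "linking coS (B 0) (C 0) = 0"
  shows "triple_linking (A s) (B s) (C s) = triple_linking (A t) (B t) (C t)"
proof -
  have z: "AB.total t = 0" "BC.total t = 0" "AC.total t = 0" "BC'.total t = 0" for t
    using zero linking_constant[of t 0] unfolding linking_eq by simp_all
  define I where "I t = triple_linking (A t) (B t) (C t)" for t
  have "(I has_real_derivative 0) (at t)" for t
  proof -
    define K1 where "K1 = (\<lambda>x y z. correction_j S 0 2 1 (B t y - A t x) (C t z - B t y) * T1.jac t x y z)"
    define K2 where "K2 = (\<lambda>x y z. correction_j S 1 1 2 (B t y - A t x) (C t z - B t y) * T2.jac t x y z)"
    define K3 where "K3 = (\<lambda>z y x. correction_j coS 1 2 1 (B t y - C t z) (A t x - B t y) * T3.jac t z y x)"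
    define K4 where "K4 = (\<lambda>z y x. correction_j coS 0 1 2 (B t y - C t z) (A t x - B t y) * T4.jac t z y x)"
    have c: "continuous_on UNIV (\<lambda>(x, y, z). K1 x y z)" "continuous_on UNIV (\<lambda>(x, y, z). K2 x y z)"
      "continuous_on UNIV (\<lambda>(x, y, z). K3 x y z)" "continuous_on UNIV (\<lambda>(x, y, z). K4 x y z)"
      unfolding split_beta K1_def K2_def K3_def K4_def
      by (intro T1.continuous_triple(2)[THEN continuous_on_slice4] T2.continuous_triple(2)[THEN continuous_on_slice4]
         T3.continuous_triple(2)[THEN continuous_on_slice4] T4.continuous_triple(2)[THEN continuous_on_slice4]
         continuous_intros)+
    have cE: "continuous_on UNIV (\<lambda>(x, y, z). wedge_AB_BC t x y z)" "continuous_on UNIV (\<lambda>(x, y, z). wedge_AB_AC t x y z)"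
      "continuous_on UNIV (\<lambda>(x, y, z). wedge_AC_BC t x y z)"
      unfolding split_beta wedge_AB_BC_def wedge_AB_AC_def wedge_AC_BC_def by (intro continuous_intros)+
    have c': "continuous_on UNIV (\<lambda>(x, y, z). K3 z y x)" "continuous_on UNIV (\<lambda>(x, y, z). K4 z y x)"
      unfolding split_beta by (intro c[THEN continuous_on_slice3] continuous_intros)+
    have "(I has_real_derivative torus_integral (wedge_AB_BC t) - torus_integral (wedge_AB_AC t) + torus_integral (wedge_AC_BC t)
        + torus_integral K1 - torus_integral K2 + torus_integral K3 - torus_integral K4) (at t)"
      unfolding I_def triple_linking_eq K1_def K2_def K3_def K4_def
      by (intro DERIV_add DERIV_diff cup_AB_BC cup_AB_AC cup_AC_BC z T1.torus_vol_has_derivative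
        T2.torus_vol_has_derivative T3.torus_vol_has_derivative T4.torus_vol_has_derivative)
    also have "torus_integral K3 = torus_integral (\<lambda>x y z. K3 z y x)"
      using torus_reverse[OF c(3)] by simp
    also have "torus_integral K4 = torus_integral (\<lambda>x y z. K4 z y x)"
      using torus_reverse[OF c(4)] by simp
    also have "torus_integral (wedge_AB_BC t) - torus_integral (wedge_AB_AC t) + torus_integral (wedge_AC_BC t) + torus_integral K1 - torus_integral K2
        + torus_integral (\<lambda>x y z. K3 z y x) - torus_integral (\<lambda>x y z. K4 z y x)
      = torus_integral (\<lambda>x y z. wedge_AB_BC t x y z - wedge_AB_AC t x y z + wedge_AC_BC t x y z + K1 x y z - K2 x y z + K3 z y x - K4 z y x)"
    proof -
      \<comment> \<open>Continuity and the value of the integral are carried along together, so that sums split term by term.\<close>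
      define P where "P f v \<longleftrightarrow> continuous_on UNIV (\<lambda>(x, y, z). f x y z) \<and> torus_integral f = v"
        for f :: "real \<Rightarrow> real \<Rightarrow> real \<Rightarrow> real" and v
      have base: "P f (torus_integral f)" if "continuous_on UNIV (\<lambda>(x, y, z). f x y z)" for f
        using that by (simp add: P_def)
      have add: "P (\<lambda>x y z. f x y z + g x y z) (v + w)" if "P f v" "P g w" for f g v w
        using that by (auto simp: P_def torus_add split_beta intro!: continuous_intros)
      have diff: "P (\<lambda>x y z. f x y z - g x y z) (v - w)" if "P f v" "P g w" for f g v w
        using that by (auto simp: P_def torus_diff split_beta intro!: continuous_intros)
      have "P (\<lambda>x y z. wedge_AB_BC t x y z - wedge_AB_AC t x y z + wedge_AC_BC t x y z + K1 x y z - K2 x y z + K3 z y x - K4 z y x)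
        (torus_integral (wedge_AB_BC t) - torus_integral (wedge_AB_AC t) + torus_integral (wedge_AC_BC t) + torus_integral K1 - torus_integral K2
          + torus_integral (\<lambda>x y z. K3 z y x) - torus_integral (\<lambda>x y z. K4 z y x))"
        by (intro add diff base c(1,2) c' cE)
      then show ?thesis by (simp add: P_def)
    qed
    also have "\<dots> = 0"
      unfolding K1_def K2_def K3_def K4_def arnold_relation by simp
    finally show ?thesis .
  qed
  then have "I s = I t" by (intro DERIV_isconst_all allI)
  then show ?thesis by (simp add: I_def)
qed

end

section \<open>The values on the Borromean rings and on the unlink\<close>

lemma circ_pos:
  assumes f: "continuous_on UNIV f" and nonneg: "\<And>x. 0 \<le> f x"
    and pos: "0 < f c" "0 \<le> c" "c \<le> 2 * pi"
  shows "0 < circle_integral f"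
proof -
  have c: "continuous_on {0..2 * pi} f" using f by (rule continuous_on_subset) simp
  have "0 \<le> circle_integral f" unfolding circle_integral_def using nonneg c
    by (intro integral_nonneg integrable_continuous_real) auto
  moreover have "circle_integral f \<noteq> 0"
    unfolding circle_integral_def using integral_eq_0_iff[OF c] nonneg pos by force
  ultimately show ?thesis by simp
qed

lemma circ_nonneg:
  assumes f: "continuous_on UNIV f" and nonneg: "\<And>x. 0 \<le> f x"
  shows "0 \<le> circle_integral f"
proof -
  have c: "continuous_on {0..2 * pi} f" using f by (rule continuous_on_subset) simp
  show ?thesis unfolding circle_integral_def using nonneg c
    by (intro integral_nonneg integrable_continuous_real) auto
qed

lemma ellipse_vector_derivative:
  fixes u v w :: "real^3"
  shows "vector_derivative (\<lambda>x. cos x *\<^sub>R u + sin x *\<^sub>R v + w) (at x) = - sin x *\<^sub>R u + cos x *\<^sub>R v"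
  by (rule vector_derivative_at) (auto intro!: derivative_eq_intros)

lemma tangent_f1: "vector_derivative f1 (at x) = vector [0, - 2 * sin x, cos x]"
proof -
  have eq: "f1 = (\<lambda>x. cos x *\<^sub>R vector [0, 2, 0] + sin x *\<^sub>R vector [0, 0, 1] + 0)"
    by (simp add: fun_eq_iff f1_def vec_eq_iff forall_3)
  show ?thesis
    by (subst eq, subst ellipse_vector_derivative) (simp add: vec_eq_iff forall_3)
qed

lemma tangent_f2: "vector_derivative f2 (at x) = vector [- sin x, 0, 2 * cos x]"
proof -
  have eq: "f2 = (\<lambda>x. cos x *\<^sub>R vector [1, 0, 0] + sin x *\<^sub>R vector [0, 0, 2] + 0)"
    by (simp add: fun_eq_iff f2_def vec_eq_iff forall_3)
  show ?thesis
    by (subst eq, subst ellipse_vector_derivative) (simp add: vec_eq_iff forall_3)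
qed

lemma tangent_f3: "vector_derivative f3 (at x) = vector [- 2 * sin x, cos x, 0]"
proof -
  have eq: "f3 = (\<lambda>x. cos x *\<^sub>R vector [2, 0, 0] + sin x *\<^sub>R vector [0, 1, 0] + 0)"
    by (simp add: fun_eq_iff f3_def vec_eq_iff forall_3)
  show ?thesis
    by (subst eq, subst ellipse_vector_derivative) (simp add: vec_eq_iff forall_3)
qed

lemma cup_zero [simp]: "cup (\<lambda>x. 0) w = 0" "cup w (\<lambda>x. 0) = 0"
  by (simp_all add: cup_def primitive_def)

lemma unit_circle_bound:
  fixes s c :: real
  assumes "s\<^sup>2 + c\<^sup>2 = 1" "\<bar>s\<bar> \<le> 3/5"
  shows "4/5 \<le> \<bar>c\<bar>"
proof (rule ccontr)
  assume "\<not> ?thesis"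
  then have "c\<^sup>2 < (4/5)\<^sup>2" using power_strict_mono[of "\<bar>c\<bar>" "4/5" 2] by simp
  moreover have "s\<^sup>2 \<le> (3/5)\<^sup>2" using assms(2) power_mono[of "\<bar>s\<bar>" "3/5" 2] by simp
  ultimately show False using assms(1) by (simp add: power2_eq_square)
qed

lemma cos_bound: "\<bar>sin x\<bar> \<le> 3/5 \<Longrightarrow> 4/5 \<le> \<bar>cos x\<bar>" for x :: real
  by (rule unit_circle_bound[of "sin x"]) auto

lemma sin_bound: "\<bar>cos x\<bar> \<le> 3/5 \<Longrightarrow> 4/5 \<le> \<bar>sin x\<bar>" for x :: real
  by (rule unit_circle_bound[of "cos x"]) auto

context step_kernel
begin

lemma bump_zero: "e \<le> \<bar>p $ 1\<bar> \<or> e \<le> \<bar>p $ 2\<bar> \<Longrightarrow> bump h p = 0"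
  by (auto simp: bump_def a_zero)

lemma correction_zero: "e \<le> \<bar>p $ 1\<bar> \<or> e \<le> \<bar>p $ 2\<bar> \<Longrightarrow> correction h c i j p q = 0"
  by (auto simp: correction_def a_zero)

lemma a_nonneg: "0 \<le> a u"
  using a_pos[of u] a_zero[of u] by (cases "\<bar>u\<bar> < e") auto

lemma S_same: "e \<le> u \<and> e \<le> v \<or> u \<le> - e \<and> v \<le> - e \<Longrightarrow> S u = S v"
  using S_high[of u] S_high[of v] S_low[of u] S_low[of v] by auto

lemma S_nonneg: "0 \<le> S u" and S_le_1: "S u \<le> 1"
proof -
  have mono: "S u \<le> S v" if "u \<le> v" for u v
    by (rule DERIV_nonneg_imp_nondecreasing[OF that]) (use S_deriv a_nonneg in blast)
  show "0 \<le> S u" using mono[of "min u (- e)" u] S_low[of "min u (- e)"] by auto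
  show "S u \<le> 1" using mono[of u "max u e"] S_high[of "max u e"] by auto
qed

text \<open>
  In the projection the second component of the unlink is far from the other two.
\<close>

lemma unlink_density:
  assumes "e \<le> 1/10"
  shows "density h f1 e2 = (\<lambda>x y. 0)" "density h e2 f3 = (\<lambda>y z. 0)"
    "triple_density h c i j f1 e2 f3 = (\<lambda>x y z. 0)" "triple_density h c i j f3 e2 f1 = (\<lambda>z y x. 0)"
proof -
  have far: "e \<le> \<bar>4 - 2 * cos x\<bar>" "e \<le> \<bar>4 - sin x\<bar>" "e \<le> \<bar>sin x - 4\<bar>" for x :: real
    using cos_le_one[of x] sin_le_one[of x] assms by linarith+
  show "density h f1 e2 = (\<lambda>x y. 0)" "density h e2 f3 = (\<lambda>y z. 0)"
    unfolding density_def by (intro ext; subst bump_zero; simp add: f1_def e2_def f3_def far)+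
  show "triple_density h c i j f1 e2 f3 = (\<lambda>x y z. 0)" "triple_density h c i j f3 e2 f1 = (\<lambda>z y x. 0)"
    unfolding triple_density_def by (intro ext; subst correction_zero; simp add: f1_def e2_def f3_def far)+
qed

lemma triple_linking_unlink:
  assumes "e \<le> 1/10"
  shows "triple_linking f1 e2 f3 = 0"
  by (simp add: triple_linking_def unlink_density[OF assms])

lemma linking_unlink:
  assumes "e \<le> 1/10"
  shows "linking h f1 e2 = 0" "linking h e2 f3 = 0"
  by (simp_all add: linking_def unlink_density[OF assms])

lemma density_13: "density S f1 f3 x z =
    (2 * sin z * a (2 * cos z)) * (S (- sin x) * (2 * sin x * a (sin z - 2 * cos x)))"
  by (simp add: density_def bump_def tangent_f1 tangent_f3 f1_def f3_def planar_cross_def)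

text \<open>
  For fixed \<open>z\<close> the integrand is, up to a term with \<open>a (sin x)\<close>, the \<open>x\<close>-derivative of the periodic
  function \<open>S (- sin x) * S (sin z - 2 * cos x)\<close>. That term is supported where \<open>cos x\<close> is near 1 or -1, so its
  integral \<open>k\<close> is independent of \<open>z\<close>, and the remaining factor is itself a \<open>z\<close>-derivative.
\<close>

lemma linking_13:
  assumes "e \<le> 1/10"
  shows "linking S f1 f3 = 0"
proof -
  define k where "k = circle_integral (\<lambda>x. cos x * a (sin x) * S (- 2 * cos x))"
  \<comment> \<open>The value of the inner integral does not depend on z.\<close>
  have inner: "circle_integral (\<lambda>x. S (- sin x) * (2 * sin x * a (sin z - 2 * cos x))) = k" for z
  proof -
    have "((\<lambda>x. S (- sin x) * S (sin z - 2 * cos x)) has_real_derivative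
        S (- sin x) * (2 * sin x * a (sin z - 2 * cos x)) - cos x * a (sin x) * S (sin z - 2 * cos x)) (at x)" for x
      by (rule DERIV_cong, rule DERIV_mult, (rule DERIV_chain2[OF S_deriv], (rule derivative_eq_intros refl)+)+)
        (simp add: a_minus)
    from circ_derivative[OF this]
    have "circle_integral (\<lambda>x. S (- sin x) * (2 * sin x * a (sin z - 2 * cos x)) - cos x * a (sin x) * S (sin z - 2 * cos x)) = 0"
      by simp
    then have "circle_integral (\<lambda>x. S (- sin x) * (2 * sin x * a (sin z - 2 * cos x)))
      = circle_integral (\<lambda>x. cos x * a (sin x) * S (sin z - 2 * cos x))"
      by (subst (asm) circ_diff) (auto intro!: continuous_intros)
    also have "\<dots> = k"
      unfolding k_def
    proof (rule circ_cong)
      fix x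
      show "cos x * a (sin x) * S (sin z - 2 * cos x) = cos x * a (sin x) * S (- 2 * cos x)"
      proof (cases "a (sin x) = 0")
        case False
        then have "4/5 \<le> \<bar>cos x\<bar>"
          using a_nonzero assms by (intro cos_bound) force
        then have "S (sin z - 2 * cos x) = S (- 2 * cos x)"
          using assms sin_le_one[of z] sin_ge_minus_one[of z] by (intro S_same) arith
        then show ?thesis by simp
      qed simp
    qed
    finally show ?thesis .
  qed
  have "linking S f1 f3 = circle_integral (\<lambda>z. circle_integral (\<lambda>x. density S f1 f3 x z))"
    unfolding linking_def density_13
    by (rule circ_swap) (unfold split_beta, intro continuous_intros)
  also have "\<dots> = circle_integral (\<lambda>z. 2 * sin z * a (2 * cos z)) * k"
    by (simp only: density_13 circ_cmult inner circ_multc)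
  also have "circle_integral (\<lambda>z. 2 * sin z * a (2 * cos z)) = 0"
  proof -
    have "((\<lambda>z. - S (2 * cos z)) has_real_derivative 2 * sin z * a (2 * cos z)) (at z)" for z
      by (rule DERIV_cong, rule DERIV_minus, rule DERIV_chain2[OF S_deriv], (rule derivative_eq_intros refl)+) simp
    from circ_derivative[OF this] show ?thesis by simp
  qed
  finally show ?thesis by simp
qed

text \<open>
  The second and third rings do not meet in the projection, so there are no crossings between them and
  no triple points either.
\<close>

lemma borromean_density:
  assumes e: "e \<le> 1/10"
  shows "density h f2 f3 = (\<lambda>y z. 0)"
    "triple_density h c i j f3 f2 f1 = (\<lambda>z y x. 0)"
    "triple_density S 0 2 1 f1 f2 f3 = (\<lambda>x y z. 0)" "triple_density S 1 1 2 f1 f2 f3 = (\<lambda>x y z. 0)"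
proof -
  have far: "e \<le> \<bar>2 * cos z - cos y\<bar> \<or> e \<le> \<bar>sin z\<bar>" "e \<le> \<bar>cos y - 2 * cos z\<bar> \<or> e \<le> \<bar>sin z\<bar>" for y z
    using cos_bound[of z] cos_le_one[of y] cos_ge_minus_one[of y] e by linarith+
  show "density h f2 f3 = (\<lambda>y z. 0)"
    unfolding density_def by (intro ext; subst bump_zero) (use far in \<open>simp_all add: f2_def f3_def\<close>)
  show "triple_density h c i j f3 f2 f1 = (\<lambda>z y x. 0)"
    unfolding triple_density_def
    by (intro ext; subst correction_zero) (use far in \<open>simp_all add: f2_def f3_def\<close>)
  have "S (2 * cos z - cos y) = S (2 * cos z)" if "\<bar>sin z\<bar> < e" for y z
    using cos_bound[of z] cos_le_one[of y] cos_ge_minus_one[of y] e that by (intro S_same) arith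
  then show "triple_density S 0 2 1 f1 f2 f3 = (\<lambda>x y z. 0)"
    using a_nonzero by (fastforce simp: fun_eq_iff triple_density_def correction_def f1_def f2_def f3_def)
  have "S (sin z) = S (sin z - 2 * cos x)" if "\<bar>2 * cos x\<bar> < e" "\<bar>2 * cos z\<bar> < e" for x z
    using sin_bound[of z] e that by (intro S_same) arith
  then show "triple_density S 1 1 2 f1 f2 f3 = (\<lambda>x y z. 0)"
    using a_nonzero a_minus by (fastforce simp: fun_eq_iff triple_density_def correction_def f1_def f2_def f3_def)
qed

text \<open>
  Only the product of the crossings of the first ring with the other two is left. The crossings with the
  second ring lie near \<open>cos x = 0\<close>, with opposite signs, so the primitive of their density is a constant \<open>K\<close> on
  the half circle \<open>cos x < 0\<close> and zero on the other half, up to smearing. Of the two crossings at which the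
  first ring passes below the third, near \<open>x = 4 * pi / 3\<close> and \<open>x = 5 * pi / 3\<close>, the first half contains
  just one, and so it decides the sign.
\<close>

lemma triple_linking_borromean:
  assumes e: "e \<le> 1/10"
  shows "triple_linking f1 f2 f3 < 0"
proof -
  define K where "K = circle_integral (\<lambda>y. S (2 * sin y) * a (cos y) * sin y)"
  have "0 < K"
    unfolding K_def
  proof (rule circ_pos[where c="pi / 2"])
    show "continuous_on UNIV (\<lambda>y. S (2 * sin y) * a (cos y) * sin y)"
      by (intro continuous_intros)
    show "0 \<le> S (2 * sin y) * a (cos y) * sin y" for y
    proof (cases "a (cos y) = 0 \<or> 0 \<le> sin y")
      case False
      then have "S (2 * sin y) = 0"
        using sin_bound[of y] a_nonzero[of "cos y"] e by (intro S_low) force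
      then show ?thesis by simp
    qed (auto simp: S_nonneg a_nonneg)
    show "0 < S (2 * sin (pi / 2)) * a (cos (pi / 2)) * sin (pi / 2)"
      using S_high[of 2] a_pos[of 0] e e_pos by simp
  qed (use pi_gt_zero in linarith)+
  have W1: "circle_integral (\<lambda>y. density S f1 f2 x y) = K * (2 * sin x * a (2 * cos x))" for x
  proof -
    have "density S f1 f2 x y = (2 * sin x * a (2 * cos x)) * (S (2 * sin y) * a (cos y) * sin y)" for y
    proof -
      have "S (2 * sin y - sin x) = S (2 * sin y)" if "\<bar>2 * cos x\<bar> < e" "\<bar>cos y\<bar> < e"
        using sin_bound[of y] e that sin_le_one[of x] sin_ge_minus_one[of x] by (intro S_same) arith
      then show ?thesis
        using a_nonzero[of "2 * cos x"] a_nonzero[of "cos y"] a_minus[of "2 * cos x"]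
        by (auto simp: density_def bump_def tangent_f1 tangent_f2 f1_def f2_def planar_cross_def)
    qed
    then show ?thesis by (simp add: circ_cmult K_def)
  qed
  have prim: "primitive (\<lambda>x. K * (2 * sin x * a (2 * cos x))) x = K * (1 - S (2 * cos x))" for x
  proof -
    have "((\<lambda>x. - K * S (2 * cos x)) has_real_derivative K * (2 * sin x * a (2 * cos x))) (at x)" for x
      by (rule DERIV_cong, rule DERIV_cmult, rule DERIV_chain2[OF S_deriv], (rule derivative_eq_intros refl)+) simp
    from primitive_eq[OF this] show ?thesis
      using S_high[of 2] e by (simp add: algebra_simps)
  qed
  define g where "g x z = (1 - S (2 * cos x)) * density S f1 f3 x z" for x z
  have g_cont: "continuous_on UNIV (\<lambda>(x, z). g x z)"
    unfolding split_beta g_def density_13 by (intro continuous_intros)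
  have g_nonneg: "0 \<le> g x z" for x z
  proof (cases "a (2 * cos z) = 0 \<or> a (sin z - 2 * cos x) = 0 \<or> S (2 * cos x) = 1 \<or> S (- sin x) = 0")
    case False
    then have "\<bar>2 * cos z\<bar> < e" "\<bar>sin z - 2 * cos x\<bar> < e" "2 * cos x < e" "sin x < e"
      using a_nonzero S_high[of "2 * cos x"] S_low[of "- sin x"] by force+
    then have "sin z < 0" "sin x < 0"
      using sin_bound[of z] sin_bound[of x] e sin_le_one[of z] sin_ge_minus_one[of z] by linarith+
    then have "0 \<le> sin z * sin x" by (simp add: mult_nonpos_nonpos)
    have "0 \<le> (1 - S (2 * cos x)) * (a (2 * cos z) * S (- sin x) * a (sin z - 2 * cos x) * 4) * (sin z * sin x)"
      by (rule mult_nonneg_nonneg[OF _ \<open>0 \<le> sin z * sin x\<close>]) (simp add: S_le_1 S_nonneg a_nonneg)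
    then show ?thesis by (simp add: g_def density_13 algebra_simps)
  qed (auto simp: g_def density_13)
  have g_pos: "0 < g (4 * pi / 3) (3 * pi / 2)"
  proof -
    have c: "cos (4 * pi / 3) = - 1 / 2" "sin (4 * pi / 3) = - sqrt 3 / 2"
      using cos_periodic_pi[of "pi / 3"] sin_periodic_pi[of "pi / 3"]
      by (simp_all add: cos_60 sin_60 add.commute algebra_simps)
    have c': "cos (3 * pi / 2) = 0" "sin (3 * pi / 2) = - 1"
      using cos_periodic_pi[of "pi / 2"] sin_periodic_pi[of "pi / 2"] by (simp_all add: algebra_simps)
    have "1 \<le> sqrt 3" by simp
    then have "S (sqrt 3 / 2) = 1" "S (- 1) = 0"
      using e by (intro S_high S_low; linarith)+
    then show ?thesis
      using a_pos[of 0] e_pos by (simp add: g_def density_13 c c')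
  qed
  have "0 < circle_integral (\<lambda>x. circle_integral (g x))"
  proof (rule circ_pos[where c="4 * pi / 3"])
    show "continuous_on UNIV (\<lambda>x. circle_integral (g x))"
      by (rule continuous_on_circ[OF g_cont])
    have g1: "continuous_on UNIV (g x)" for x
      using continuous_on_slice2[OF g_cont, of UNIV "\<lambda>_. x" "\<lambda>z. z"] by simp
    show "0 \<le> circle_integral (g x)" for x by (rule circ_nonneg[OF g1 g_nonneg])
    show "0 < circle_integral (g (4 * pi / 3))"
      by (rule circ_pos[OF g1 g_nonneg g_pos]) auto
  qed (use pi_gt_zero in linarith)+
  moreover have "cup (\<lambda>x. circle_integral (\<lambda>y. density S f1 f2 x y)) (\<lambda>x. circle_integral (\<lambda>z. density S f1 f3 x z))
    = K * circle_integral (\<lambda>x. circle_integral (g x))"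
    unfolding cup_def W1 prim g_def by (simp add: circ_cmult mult.assoc)
  ultimately show ?thesis
    using \<open>0 < K\<close> by (simp add: triple_linking_def borromean_density[OF e])
qed

end

section \<open>From continuous homotopies to smooth motion\<close>

lemma smooth_circle_map_derivative:
  assumes "smooth_circle_map c"
  obtains c' where "\<And>x. (c has_vector_derivative c' x) (at x)" "continuous_on UNIV c'"
    "c (2 * pi) = c 0" "c' (2 * pi) = c' 0"
proof -
  obtain D where D: "D 0 = c" "\<And>n x. (D n has_vector_derivative D (Suc n) x) (at x)"
    using assms unfolding smooth_circle_map_def smooth_def by blast
  have period: "c (x + 2 * pi) = c x" for x
    using assms by (simp add: smooth_circle_map_def)
  have deriv: "(c has_vector_derivative D (Suc 0) x) (at x)" for x
    using D(2)[of 0 x] D(1) by simp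
  have "((\<lambda>x. x + 2 * pi) has_vector_derivative 1) (at 0)"
    by (auto intro!: derivative_eq_intros simp: has_real_derivative_iff_has_vector_derivative[symmetric])
  then have "((\<lambda>x. c (x + 2 * pi)) has_vector_derivative D (Suc 0) (2 * pi)) (at 0)"
    using vector_diff_chain_at[of "\<lambda>x. x + 2 * pi" 1 0 c "D (Suc 0) (2 * pi)"] deriv[of "2 * pi"]
    by (simp add: o_def)
  then have "D (Suc 0) (2 * pi) = D (Suc 0) 0"
    unfolding period using deriv[of 0] vector_derivative_unique_at by blast
  moreover have "continuous_on UNIV (D (Suc 0))"
    by (auto simp: continuous_on_eq_continuous_at intro!: has_vector_derivative_continuous D(2))
  ultimately show thesis
    using that[OF deriv] period[of 0] by simp
qed

text \<open>
  A straight-line motion, reparametrised by \<open>(sin t)\<^sup>2\<close>: it is smooth for all real times and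
  yet never leaves the segment, with the ends at \<open>t = 0\<close> and \<open>t = pi / 2\<close>.
\<close>

definition glide :: "(real \<Rightarrow> real^3) \<Rightarrow> (real \<Rightarrow> real^3) \<Rightarrow> real \<Rightarrow> real \<Rightarrow> real^3" where
  "glide c d t x = c x + (sin t)\<^sup>2 *\<^sub>R (d x - c x)"

lemma glide_moving_curve:
  assumes "smooth_circle_map c" "smooth_circle_map d"
  obtains Ft Fx Ftx where "moving_curve (glide c d) Ft Fx Ftx"
proof -
  obtain c' where c: "\<And>x. (c has_vector_derivative c' x) (at x)" "continuous_on UNIV c'"
    "c (2 * pi) = c 0" "c' (2 * pi) = c' 0"
    using smooth_circle_map_derivative[OF assms(1)] by blast
  obtain d' where d: "\<And>x. (d has_vector_derivative d' x) (at x)" "continuous_on UNIV d'"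
    "d (2 * pi) = d 0" "d' (2 * pi) = d' 0"
    using smooth_circle_map_derivative[OF assms(2)] by blast
  have "continuous_on UNIV c" "continuous_on UNIV d"
    by (auto simp: continuous_on_eq_continuous_at intro!: has_vector_derivative_continuous c d)
  note [continuous_intros] = this[THEN continuous_on_compose2, OF _ subset_UNIV]
    c(2)[THEN continuous_on_compose2, OF _ subset_UNIV] d(2)[THEN continuous_on_compose2, OF _ subset_UNIV]
  have s: "((\<lambda>t. (sin t)\<^sup>2) has_real_derivative 2 * sin t * cos t) (at t)" for t :: real
    by (auto intro!: derivative_eq_intros)
  have "moving_curve (glide c d) (\<lambda>t x. (2 * sin t * cos t) *\<^sub>R (d x - c x))
    (\<lambda>t x. c' x + (sin t)\<^sup>2 *\<^sub>R (d' x - c' x)) (\<lambda>t x. (2 * sin t * cos t) *\<^sub>R (d' x - c' x))"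
    unfolding glide_def[abs_def]
    by unfold_locales
      (auto simp: split_beta c(3,4) d(3,4) intro!: derivative_eq_intros continuous_intros c(1) d(1) s)
  with that show thesis .
qed

context step_kernel
begin

lemma glide_invariance:
  assumes smooth: "smooth_circle_map A" "smooth_circle_map A'" "smooth_circle_map B" "smooth_circle_map B'"
      "smooth_circle_map C" "smooth_circle_map C'"
    and sep: "\<And>t x y. sep (glide B B' t y - glide A A' t x)" "\<And>t y z. sep (glide C C' t z - glide B B' t y)"
      "\<And>t x z. sep (glide C C' t z - glide A A' t x)"
  shows "linking S A B = linking S A' B'" "linking S B C = linking S B' C'"
    "linking S A C = linking S A' C'" "linking coS B C = linking coS B' C'"
    "linking S A B = 0 \<Longrightarrow> linking S B C = 0 \<Longrightarrow> linking S A C = 0 \<Longrightarrow> linking coS B C = 0 \<Longrightarrow>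
      triple_linking A B C = triple_linking A' B' C'"
proof -
  obtain At Ax Atx where A: "moving_curve (glide A A') At Ax Atx"
    using glide_moving_curve[OF smooth(1,2)] by blast
  obtain Bt Bx Btx where B: "moving_curve (glide B B') Bt Bx Btx"
    using glide_moving_curve[OF smooth(3,4)] by blast
  obtain Ct Cx Ctx where C: "moving_curve (glide C C') Ct Cx Ctx"
    using glide_moving_curve[OF smooth(5,6)] by blast
  interpret L: moving_link e S a a' "glide A A'" At Ax Atx "glide B B'" Bt Bx Btx "glide C C'" Ct Cx Ctx
    by (intro moving_link.intro moving_link_axioms.intro step_kernel_axioms A B C sep)
  have ends: "glide c d 0 = c" "glide c d (pi / 2) = d" for c d
    by (simp_all add: glide_def fun_eq_iff)
  show "linking S A B = linking S A' B'" "linking S B C = linking S B' C'"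
    "linking S A C = linking S A' C'" "linking coS B C = linking coS B' C'"
    using L.linking_constant[of 0 "pi / 2"] by (simp_all add: ends)
  show "triple_linking A B C = triple_linking A' B' C'"
    if "linking S A B = 0" "linking S B C = 0" "linking S A C = 0" "linking coS B C = 0"
    using L.triple_linking_constant[of 0 "pi / 2"] that by (simp add: ends)
qed

lemma sep_of_norm:
  assumes "6 * e \<le> norm v"
  shows "sep v"
proof (rule ccontr)
  assume "\<not> sep v"
  then have "\<bar>v $ 1\<bar> < 2 * e" "\<bar>v $ 2\<bar> < 2 * e" "\<bar>v $ 3\<bar> < 2 * e"
    by (auto simp: sep_3)
  moreover have "norm v \<le> \<bar>v $ 1\<bar> + \<bar>v $ 2\<bar> + \<bar>v $ 3\<bar>"
    using norm_le_l1_cart[of v] by (simp add: sum_3)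
  ultimately show False using assms by linarith
qed

end

text \<open>
  The representative of an angle in the compact interval \<open>{0..2 * pi}\<close>, where compactness applies.
\<close>

definition angle :: "real \<Rightarrow> real" where
  "angle x = x - 2 * pi * of_int \<lfloor>x / (2 * pi)\<rfloor>"

lemma angle_range: "angle x \<in> {0..2 * pi}"
proof -
  have "of_int \<lfloor>x / (2 * pi)\<rfloor> * (2 * pi) \<le> x"
    by (subst pos_le_divide_eq[symmetric]) auto
  moreover have "x \<le> (of_int \<lfloor>x / (2 * pi)\<rfloor> + 1) * (2 * pi)"
    by (subst pos_divide_le_eq[symmetric]) (auto intro: less_imp_le)
  ultimately show ?thesis by (simp add: angle_def algebra_simps)
qed

lemma smooth_circle_map_angle:
  assumes "smooth_circle_map f"
  shows "f (angle x) = f x"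
proof -
  interpret periodic_fun_simple f "2 * pi"
    by unfold_locales (use assms in \<open>simp add: smooth_circle_map_def\<close>)
  show ?thesis
    using minus_of_int[of x "\<lfloor>x / (2 * pi)\<rfloor>"] by (simp add: angle_def mult.commute)
qed

lemma homotopy_distance:
  fixes F G :: "real \<Rightarrow> real \<Rightarrow> real^3"
  assumes F: "continuous_on ({0..1} \<times> UNIV) (\<lambda>(t, x). F t x)"
    and G: "continuous_on ({0..1} \<times> UNIV) (\<lambda>(t, x). G t x)"
    and smooth: "\<And>t. t \<in> {0..1} \<Longrightarrow> smooth_circle_map (F t)" "\<And>t. t \<in> {0..1} \<Longrightarrow> smooth_circle_map (G t)"
    and disjoint: "\<And>t. t \<in> {0..1} \<Longrightarrow> range (F t) \<inter> range (G t) = {}"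
  obtains d where "0 < d" "\<And>t x y. t \<in> {0..1} \<Longrightarrow> d \<le> norm (G t y - F t x)"
proof -
  let ?K = "{0..1} \<times> {0..2 * pi} \<times> {0..2 * pi} :: (real \<times> real \<times> real) set"
  let ?g = "\<lambda>p. norm (G (fst p) (snd (snd p)) - F (fst p) (fst (snd p)))"
  have "continuous_on ?K ?g"
    by (intro continuous_intros
        continuous_on_compose2[OF F, of ?K "\<lambda>p. (fst p, fst (snd p))", simplified]
        continuous_on_compose2[OF G, of ?K "\<lambda>p. (fst p, snd (snd p))", simplified]) auto
  moreover have "compact ?K" by (intro compact_Times compact_Icc)
  moreover have "?K \<noteq> {}" by auto
  ultimately obtain p where p: "p \<in> ?K" "\<And>q. q \<in> ?K \<Longrightarrow> ?g p \<le> ?g q"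
    using continuous_attains_inf[of ?K ?g] by blast
  have "0 < ?g p"
    using disjoint[of "fst p"] p(1) by fastforce
  moreover have "?g p \<le> norm (G t y - F t x)" if t: "t \<in> {0..1}" for t x y
    using p(2)[of "(t, angle x, angle y)"] angle_range[of x] angle_range[of y] t
    by (simp add: smooth_circle_map_angle smooth)
  ultimately show thesis by (rule that)
qed

lemma homotopy_uniform:
  fixes F :: "real \<Rightarrow> real \<Rightarrow> real^3"
  assumes F: "continuous_on ({0..1} \<times> UNIV) (\<lambda>(t, x). F t x)"
    and smooth: "\<And>t. t \<in> {0..1} \<Longrightarrow> smooth_circle_map (F t)" and "0 < (r::real)"
  obtains \<delta> where "0 < \<delta>"
    "\<And>s t x. s \<in> {0..1} \<Longrightarrow> t \<in> {0..1} \<Longrightarrow> \<bar>s - t\<bar> < \<delta> \<Longrightarrow> norm (F s x - F t x) < r"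
proof -
  let ?K = "{0..1} \<times> {0..2 * pi} :: (real \<times> real) set"
  have "uniformly_continuous_on ?K (\<lambda>(t, x). F t x)"
    by (intro compact_uniformly_continuous compact_Times compact_Icc continuous_on_subset[OF F]) auto
  then obtain \<delta> where \<delta>: "0 < \<delta>"
    "\<And>p q. p \<in> ?K \<Longrightarrow> q \<in> ?K \<Longrightarrow> dist q p < \<delta> \<Longrightarrow> dist (case q of (t, x) \<Rightarrow> F t x) (case p of (t, x) \<Rightarrow> F t x) < r"
    unfolding uniformly_continuous_on_def using \<open>0 < r\<close> by metis
  have "norm (F s x - F t x) < r" if "s \<in> {0..1}" "t \<in> {0..1}" "\<bar>s - t\<bar> < \<delta>" for s t x
    using \<delta>(2)[of "(t, angle x)" "(s, angle x)"] that angle_range[of x] smooth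
    by (simp add: smooth_circle_map_angle dist_Pair_Pair dist_norm)
  with \<delta>(1) show thesis by (rule that)
qed

lemma glide_close:
  assumes "norm (d x - c x) \<le> r"
  shows "norm (glide c d t x - c x) \<le> r"
proof -
  have "norm (glide c d t x - c x) = (sin t)\<^sup>2 * norm (d x - c x)"
    by (simp add: glide_def)
  also have "\<dots> \<le> 1 * norm (d x - c x)"
    by (intro mult_right_mono) (auto simp: abs_square_le_1)
  finally show ?thesis using assms by simp
qed

lemma constant_chain:
  assumes "\<And>k. k < N \<Longrightarrow> f k = f (Suc k)" "k \<le> N"
  shows "f k = f N"
  using assms(2) by (induction rule: inc_induct) (use assms(1) in auto)

theorem mainTheorem4:
  shows "\<not> link_homotopic borromean_rings unlink"
proof
  assume "link_homotopic borromean_rings unlink"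
  then obtain F G H :: "real \<Rightarrow> real \<Rightarrow> real^3" where
    cont: "continuous_on ({0..1} \<times> UNIV) (\<lambda>(t, x). F t x)" "continuous_on ({0..1} \<times> UNIV) (\<lambda>(t, x). G t x)"
      "continuous_on ({0..1} \<times> UNIV) (\<lambda>(t, x). H t x)"
    and Link: "\<forall>t\<in>{0..1}. (F t, G t, H t) \<in> Link"
    and ends: "F 0 = f1" "G 0 = f2" "H 0 = f3" "F 1 = f1" "G 1 = e2" "H 1 = f3"
    unfolding link_homotopic_def borromean_rings_def unlink_def prod.inject by blast
  have smooth: "smooth_circle_map (F t)" "smooth_circle_map (G t)" "smooth_circle_map (H t)"
    and disjoint: "range (F t) \<inter> range (G t) = {}" "range (G t) \<inter> range (H t) = {}" "range (F t) \<inter> range (H t) = {}"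
    if "t \<in> {0..1}" for t
    using Link that by (auto simp: Link_def)
  obtain d1 where d1: "0 < d1" "\<And>t x y. t \<in> {0..1} \<Longrightarrow> d1 \<le> norm (G t y - F t x)"
    using homotopy_distance[OF cont(1,2) smooth(1,2) disjoint(1)] by blast
  obtain d2 where d2: "0 < d2" "\<And>t x y. t \<in> {0..1} \<Longrightarrow> d2 \<le> norm (H t y - G t x)"
    using homotopy_distance[OF cont(2,3) smooth(2,3) disjoint(2)] by blast
  obtain d3 where d3: "0 < d3" "\<And>t x y. t \<in> {0..1} \<Longrightarrow> d3 \<le> norm (H t y - F t x)"
    using homotopy_distance[OF cont(1,3) smooth(1,3) disjoint(3)] by blast
  define d where "d = min d1 (min d2 d3)"
  have d: "0 < d" "\<And>t x y. t \<in> {0..1} \<Longrightarrow> d \<le> norm (G t y - F t x)"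
    "\<And>t x y. t \<in> {0..1} \<Longrightarrow> d \<le> norm (H t y - G t x)" "\<And>t x y. t \<in> {0..1} \<Longrightarrow> d \<le> norm (H t y - F t x)"
    using d1 d2 d3 by (auto simp: d_def min_le_iff_disj)
  have "0 < d / 8" using d(1) by simp
  obtain \<delta>1 where \<delta>1: "0 < \<delta>1"
    "\<And>s t x. s \<in> {0..1} \<Longrightarrow> t \<in> {0..1} \<Longrightarrow> \<bar>s - t\<bar> < \<delta>1 \<Longrightarrow> norm (F s x - F t x) < d / 8"
    using homotopy_uniform[OF cont(1) smooth(1) \<open>0 < d / 8\<close>] by blast
  obtain \<delta>2 where \<delta>2: "0 < \<delta>2"
    "\<And>s t x. s \<in> {0..1} \<Longrightarrow> t \<in> {0..1} \<Longrightarrow> \<bar>s - t\<bar> < \<delta>2 \<Longrightarrow> norm (G s x - G t x) < d / 8"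
    using homotopy_uniform[OF cont(2) smooth(2) \<open>0 < d / 8\<close>] by blast
  obtain \<delta>3 where \<delta>3: "0 < \<delta>3"
    "\<And>s t x. s \<in> {0..1} \<Longrightarrow> t \<in> {0..1} \<Longrightarrow> \<bar>s - t\<bar> < \<delta>3 \<Longrightarrow> norm (H s x - H t x) < d / 8"
    using homotopy_uniform[OF cont(3) smooth(3) \<open>0 < d / 8\<close>] by blast
  define \<delta> where "\<delta> = min \<delta>1 (min \<delta>2 \<delta>3)"
  have "0 < \<delta>" using \<delta>1 \<delta>2 \<delta>3 by (simp add: \<delta>_def)
  then obtain N :: nat where N: "N \<noteq> 0" "inverse (real N) < \<delta>"
    using real_arch_inverse by blast
  define \<tau> where "\<tau> k = real k / real N" for k
  have \<tau>: "\<tau> k \<in> {0..1}" if "k \<le> N" for k using that N by (simp add: \<tau>_def)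
  have \<tau>_step: "\<bar>\<tau> (Suc k) - \<tau> k\<bar> < \<delta>" for k
    using N by (simp add: \<tau>_def diff_divide_distrib[symmetric] inverse_eq_divide)
  \<comment> \<open>The bound 1/10 is for the evaluation on the two given links, the other one keeps all glides separated.\<close>
  define e where "e = min (1/10) (d / 8)"
  have e: "0 < e" "e \<le> 1/10" "8 * e \<le> d" using d(1) by (auto simp: e_def)
  obtain S a a' where "step_kernel e S a a'" using step_kernel_exists[OF e(1)] .
  then interpret step_kernel e S a a' .
  \<comment> \<open>Two points at distance at least d, each displaced by at most d / 8, remain at distance 3 d / 4.\<close>
  have far: "sep (v' - u')" if "d \<le> norm (v - u)" "norm (u' - u) \<le> d / 8" "norm (v' - v) \<le> d / 8" for u v u' v'
  proof (rule sep_of_norm)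
    have "norm (v - u) \<le> norm (v' - u') + norm (u' - u) + norm (v' - v)"
      using norm_triangle_ineq[of "(v' - u') + (u' - u)" "v - v'"] norm_triangle_ineq[of "v' - u'" "u' - u"]
      by (simp add: norm_minus_commute)
    then show "6 * e \<le> norm (v' - u')" using that e(3) by linarith
  qed
  have step: "norm (F (\<tau> (Suc k)) x - F (\<tau> k) x) \<le> d / 8" "norm (G (\<tau> (Suc k)) x - G (\<tau> k) x) \<le> d / 8"
    "norm (H (\<tau> (Suc k)) x - H (\<tau> k) x) \<le> d / 8" if "k < N" for k x
    using \<delta>1(2)[of "\<tau> (Suc k)" "\<tau> k" x] \<delta>2(2)[of "\<tau> (Suc k)" "\<tau> k" x] \<delta>3(2)[of "\<tau> (Suc k)" "\<tau> k" x]
      \<tau>[of k] \<tau>[of "Suc k"] \<tau>_step[of k] that by (simp_all add: \<delta>_def)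
  have inv: "linking S (F (\<tau> k)) (G (\<tau> k)) = linking S (F (\<tau> (Suc k))) (G (\<tau> (Suc k)))"
    "linking S (G (\<tau> k)) (H (\<tau> k)) = linking S (G (\<tau> (Suc k))) (H (\<tau> (Suc k)))"
    "linking S (F (\<tau> k)) (H (\<tau> k)) = linking S (F (\<tau> (Suc k))) (H (\<tau> (Suc k)))"
    "linking coS (G (\<tau> k)) (H (\<tau> k)) = linking coS (G (\<tau> (Suc k))) (H (\<tau> (Suc k)))"
    "linking S (F (\<tau> k)) (G (\<tau> k)) = 0 \<Longrightarrow> linking S (G (\<tau> k)) (H (\<tau> k)) = 0 \<Longrightarrow>
       linking S (F (\<tau> k)) (H (\<tau> k)) = 0 \<Longrightarrow> linking coS (G (\<tau> k)) (H (\<tau> k)) = 0 \<Longrightarrow>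
      triple_linking (F (\<tau> k)) (G (\<tau> k)) (H (\<tau> k))
        = triple_linking (F (\<tau> (Suc k))) (G (\<tau> (Suc k))) (H (\<tau> (Suc k)))"
    if "k < N" for k
  proof -
    have k: "\<tau> k \<in> {0..1}" "\<tau> (Suc k) \<in> {0..1}" using \<tau>[of k] \<tau>[of "Suc k"] that by auto
    let ?F = "glide (F (\<tau> k)) (F (\<tau> (Suc k)))"
    let ?G = "glide (G (\<tau> k)) (G (\<tau> (Suc k)))"
    let ?H = "glide (H (\<tau> k)) (H (\<tau> (Suc k)))"
    have close: "norm (?F t x - F (\<tau> k) x) \<le> d / 8" "norm (?G t x - G (\<tau> k) x) \<le> d / 8"
      "norm (?H t x - H (\<tau> k) x) \<le> d / 8" for t x
      using step[OF that] by (intro glide_close; blast)+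
    have sep: "sep (?G t y - ?F t x)" "sep (?H t y - ?G t x)" "sep (?H t y - ?F t x)" for t x y
      by (rule far[OF d(2)[OF k(1)] close(1,2)] far[OF d(3)[OF k(1)] close(2,3)]
          far[OF d(4)[OF k(1)] close(1,3)])+
    note g = glide_invariance[OF smooth(1)[OF k(1)] smooth(1)[OF k(2)] smooth(2)[OF k(1)] smooth(2)[OF k(2)]
        smooth(3)[OF k(1)] smooth(3)[OF k(2)] sep]
    show "linking S (F (\<tau> k)) (G (\<tau> k)) = linking S (F (\<tau> (Suc k))) (G (\<tau> (Suc k)))"
      "linking S (G (\<tau> k)) (H (\<tau> k)) = linking S (G (\<tau> (Suc k))) (H (\<tau> (Suc k)))"
      "linking S (F (\<tau> k)) (H (\<tau> k)) = linking S (F (\<tau> (Suc k))) (H (\<tau> (Suc k)))"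
      "linking coS (G (\<tau> k)) (H (\<tau> k)) = linking coS (G (\<tau> (Suc k))) (H (\<tau> (Suc k)))"
      by (fact g)+
    show "triple_linking (F (\<tau> k)) (G (\<tau> k)) (H (\<tau> k))
        = triple_linking (F (\<tau> (Suc k))) (G (\<tau> (Suc k))) (H (\<tau> (Suc k)))"
      if "linking S (F (\<tau> k)) (G (\<tau> k)) = 0" "linking S (G (\<tau> k)) (H (\<tau> k)) = 0"
       "linking S (F (\<tau> k)) (H (\<tau> k)) = 0" "linking coS (G (\<tau> k)) (H (\<tau> k)) = 0"
      by (rule g(5)[OF that])
  qed
  have \<tau>_ends: "\<tau> 0 = 0" "\<tau> N = 1" using N by (simp_all add: \<tau>_def)
  have zero: "linking S (F (\<tau> k)) (G (\<tau> k)) = 0" "linking S (G (\<tau> k)) (H (\<tau> k)) = 0"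
    "linking S (F (\<tau> k)) (H (\<tau> k)) = 0" "linking coS (G (\<tau> k)) (H (\<tau> k)) = 0" if "k \<le> N" for k
    using constant_chain[of N "\<lambda>k. linking S (F (\<tau> k)) (G (\<tau> k))", OF inv(1) that]
      constant_chain[of N "\<lambda>k. linking S (G (\<tau> k)) (H (\<tau> k))", OF inv(2) that]
      constant_chain[of N "\<lambda>k. linking S (F (\<tau> k)) (H (\<tau> k))", OF inv(3) that]
      constant_chain[of N "\<lambda>k. linking coS (G (\<tau> k)) (H (\<tau> k))", OF inv(4) that]
    by (simp_all add: \<tau>_ends ends linking_unlink[OF e(2)] linking_13[OF e(2)])
  have "triple_linking (F (\<tau> 0)) (G (\<tau> 0)) (H (\<tau> 0)) = triple_linking (F (\<tau> N)) (G (\<tau> N)) (H (\<tau> N))"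
    by (rule constant_chain[of N "\<lambda>k. triple_linking (F (\<tau> k)) (G (\<tau> k)) (H (\<tau> k))"])
      (auto intro!: inv(5) zero)
  then show False
    using triple_linking_borromean[OF e(2)] triple_linking_unlink[OF e(2)] by (simp add: \<tau>_ends ends)
qed

end
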